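(* Let $\psi$ be a $\mathcal{T}$-formula in d-DNNF which is $\mathcal{T}$-reduced with respect to a finite set of atoms $\boldsymbol{\alpha}$ containing its atoms, and let $\beta$ be a clause on $\boldsymbol{\alpha}$. Then: (a) the $\mathcal{T}$-satisfiability of $\psi$ can be decided in time polynomial in the size of $\psi$; (b) whether $\psi\models_{\mathcal{T}}\beta$ can be decided in time polynomial in the sizes of $\psi$ and $\beta$; (c) $\#\mathrm{SMT}(\psi)$ can be computed in time polynomial in the size of $\psi$; (d) $\mathrm{AllSMT}(\psi)$ can be computed in time polynomial in the size of $\psi$ and the size of the output set.
   Context: $\mathcal{T}$-formulas are quantifier-free formulas built by Boolean connectives from $\mathcal{T}$-atoms and Boolean atoms, represented as DAGs (identical subformulas shared); size is the number of DAG nodes. The Boolean abstraction maps each atom bijectively to a fresh Boolean variable; $\psi\models_p\chi$ means the abstraction of $\psi$ propositionally entails that of $\chi$. A formula is in NNF if its internal nodes are only $\wedge,\vee$ with negations only on atoms; it is decomposable if the children of every $\wedge$-node share no atoms, deterministic if the children of every $\vee$-node are pairwise propositionally inconsistent; d-DNNF = decomposable and deterministic NNF. A $\mathcal{T}$-formula is in d-DNNF iff its Boolean abstraction is. A total truth assignment on $\boldsymbol{\alpha}$ is a conjunction containing, for each $a\in\boldsymbol{\alpha}$, exactly one of $a,\neg a$. $H_{\boldsymbol{\alpha}}(\psi)$ (resp. $P_{\boldsymbol{\alpha}}(\psi)$) is the set of $\mathcal{T}$-satisfiable (resp. $\mathcal{T}$-unsatisfiable) total truth assignments $\eta$ on $\boldsymbol{\alpha}$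 with $\eta\models_p\psi$; $\psi$ is $\mathcal{T}$-reduced with respect to $\boldsymbol{\alpha}$ iff $P_{\boldsymbol{\alpha}}(\psi)=\emptyset$. $\#\mathrm{SMT}(\psi)=|H_{\boldsymbol{\alpha}}(\psi)|$ and $\mathrm{AllSMT}(\psi)=H_{\boldsymbol{\alpha}}(\psi)$.
   Formalization: In (c) the time is polynomial in the size of ψ plus the number of atoms of α not occurring in ψ; with the size of ψ alone the claim fails (ψ = A, α = {A, B1, …, Bn} Boolean atoms: the count 2^n has n+1 bits). *)

theory Defs
  imports "HOL-Library.FSet" "HOL-Computational_Algebra.Polynomial"
begin

section \<open>Formulas as shared DAGs\<close>

text \<open>
  Conjunction and disjunction take finite sets of children; the constants true and false are
  \<open>And {||}\<close> and \<open>Or {||}\<close>.  Since identical subformulas are shared, the nodes of the DAG of a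
  formula are exactly its distinct subformulas.
\<close>

datatype (atoms: 'a) form =
    Atom 'a
  | Neg "'a form"
  | And "'a form fset"
  | Or "'a form fset"
  | Imp "'a form" "'a form"
  | Iff "'a form" "'a form"

primrec subforms :: "'a form \<Rightarrow> 'a form set" where
  "subforms (Atom a) = {Atom a}"
| "subforms (Neg f) = insert (Neg f) (subforms f)"
| "subforms (And S) = insert (And S) (\<Union>(fset (subforms |`| S)))"
| "subforms (Or S) = insert (Or S) (\<Union>(fset (subforms |`| S)))"
| "subforms (Imp f g) = insert (Imp f g) (subforms f \<union> subforms g)"
| "subforms (Iff f g) = insert (Iff f g) (subforms f \<union> subforms g)"

lemma finite_subforms: "finite (subforms f)"
  by (induction f) auto

definition dag_size :: "'a form \<Rightarrow> nat" where
  "dag_size f = card (subforms f)"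

fun children :: "'a form \<Rightarrow> 'a form set" where
  "children (Atom a) = {}"
| "children (Neg f) = {f}"
| "children (And S) = fset S"
| "children (Or S) = fset S"
| "children (Imp f g) = {f, g}"
| "children (Iff f g) = {f, g}"

text \<open>
  Propositional semantics.  Each atom is identified with the Boolean variable abstracting it, so
  the abstraction of a formula over \<open>'a\<close> is evaluated under arbitrary valuations of \<open>'a\<close>.
\<close>

primrec sat :: "('a \<Rightarrow> bool) \<Rightarrow> 'a form \<Rightarrow> bool" where
  "sat v (Atom a) \<longleftrightarrow> v a"
| "sat v (Neg f) \<longleftrightarrow> \<not> sat v f"
| "sat v (And S) \<longleftrightarrow> (\<forall>b |\<in>| sat v |`| S. b)"
| "sat v (Or S) \<longleftrightarrow> (\<exists>b |\<in>| sat v |`| S. b)"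
| "sat v (Imp f g) \<longleftrightarrow> (sat v f \<longrightarrow> sat v g)"
| "sat v (Iff f g) \<longleftrightarrow> (sat v f \<longleftrightarrow> sat v g)"

definition prop_entails :: "'a form \<Rightarrow> 'a form \<Rightarrow> bool"  (infix \<open>\<Turnstile>\<^sub>p\<close> 50) where
  "f \<Turnstile>\<^sub>p g \<longleftrightarrow> (\<forall>v. sat v f \<longrightarrow> sat v g)"

section \<open>d-DNNF\<close>

fun is_literal :: "'a form \<Rightarrow> bool" where
  "is_literal (Atom a) = True"
| "is_literal (Neg (Atom a)) = True"
| "is_literal _ = False"

definition nnf :: "'a form \<Rightarrow> bool" where
  "nnf f \<longleftrightarrow> (\<forall>g \<in> subforms f. is_literal g \<or> (\<exists>S. g = And S) \<or> (\<exists>S. g = Or S))"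

definition decomposable :: "'a form \<Rightarrow> bool" where
  "decomposable f \<longleftrightarrow>
     (\<forall>S. And S \<in> subforms f \<longrightarrow>
        (\<forall>g |\<in>| S. \<forall>h |\<in>| S. g \<noteq> h \<longrightarrow> atoms g \<inter> atoms h = {}))"

definition deterministic :: "'a form \<Rightarrow> bool" where
  "deterministic f \<longleftrightarrow>
     (\<forall>S. Or S \<in> subforms f \<longrightarrow>
        (\<forall>g |\<in>| S. \<forall>h |\<in>| S. g \<noteq> h \<longrightarrow> \<not> (\<exists>v. sat v g \<and> sat v h)))"

definition d_DNNF :: "'a form \<Rightarrow> bool" where
  "d_DNNF f \<longleftrightarrow> nnf f \<and> decomposable f \<and> deterministic f"

definition total_assignment :: "'a set \<Rightarrow> 'a form \<Rightarrow> bool" where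
  "total_assignment \<alpha> \<eta> \<longleftrightarrow>
     (\<exists>S. \<eta> = And S \<and> (\<forall>l |\<in>| S. is_literal l \<and> atoms l \<subseteq> \<alpha>) \<and>
          (\<forall>a \<in> \<alpha>. (Atom a |\<in>| S) \<noteq> (Neg (Atom a) |\<in>| S)))"

definition clause_on :: "'a set \<Rightarrow> 'a form \<Rightarrow> bool" where
  "clause_on \<alpha> \<beta> \<longleftrightarrow> (\<exists>S. \<beta> = Or S \<and> (\<forall>l |\<in>| S. is_literal l \<and> atoms l \<subseteq> \<alpha>))"

section \<open>Satisfiability modulo a theory\<close>

text \<open>
  A theory is given by its interpretations, i.e. its models together with values for the free
  variables occurring in theory atoms, and by the truth of theory atoms in them.  Nothing is
  assumed about the syntax of theory atoms or about the decidability of the theory.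
  Boolean atoms are not constrained by the theory.
\<close>

datatype ('m, 't) smt_theory = Smt_Theory (interps: "'m set") (holds: "'m \<Rightarrow> 't \<Rightarrow> bool")

datatype ('t, 'b) atom = TAtom 't | BAtom 'b

primrec truth :: "('m, 't) smt_theory \<Rightarrow> 'm \<Rightarrow> ('b \<Rightarrow> bool) \<Rightarrow> ('t, 'b) atom \<Rightarrow> bool" where
  "truth T M b (TAtom t) = holds T M t"
| "truth T M b (BAtom x) = b x"

definition T_sat :: "('m, 't) smt_theory \<Rightarrow> ('t, 'b) atom form \<Rightarrow> bool" where
  "T_sat T f \<longleftrightarrow> (\<exists>M \<in> interps T. \<exists>b. sat (truth T M b) f)"

definition T_entails ::
  "('m, 't) smt_theory \<Rightarrow> ('t, 'b) atom form \<Rightarrow> ('t, 'b) atom form \<Rightarrow> bool" where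
  "T_entails T f g \<longleftrightarrow>
     (\<forall>M \<in> interps T. \<forall>b. sat (truth T M b) f \<longrightarrow> sat (truth T M b) g)"

definition H_assignments :: "('m, 't) smt_theory \<Rightarrow> ('t, 'b) atom set \<Rightarrow> ('t, 'b) atom form
    \<Rightarrow> ('t, 'b) atom form set" where
  "H_assignments T \<alpha> f = {\<eta>. total_assignment \<alpha> \<eta> \<and> T_sat T \<eta> \<and> \<eta> \<Turnstile>\<^sub>p f}"

definition P_assignments :: "('m, 't) smt_theory \<Rightarrow> ('t, 'b) atom set \<Rightarrow> ('t, 'b) atom form
    \<Rightarrow> ('t, 'b) atom form set" where
  "P_assignments T \<alpha> f = {\<eta>. total_assignment \<alpha> \<eta> \<and> \<not> T_sat T \<eta> \<and> \<eta> \<Turnstile>\<^sub>p f}"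

definition T_reduced ::
  "('m, 't) smt_theory \<Rightarrow> ('t, 'b) atom set \<Rightarrow> ('t, 'b) atom form \<Rightarrow> bool" where
  "T_reduced T \<alpha> f \<longleftrightarrow> P_assignments T \<alpha> f = {}"

definition AllSMT :: "('m, 't) smt_theory \<Rightarrow> ('t, 'b) atom set \<Rightarrow> ('t, 'b) atom form
    \<Rightarrow> ('t, 'b) atom form set" where
  "AllSMT T \<alpha> f = H_assignments T \<alpha> f"

definition count_SMT ::
  "('m, 't) smt_theory \<Rightarrow> ('t, 'b) atom set \<Rightarrow> ('t, 'b) atom form \<Rightarrow> nat" where
  "count_SMT T \<alpha> f = card (H_assignments T \<alpha> f)"

section \<open>Machine model\<close>

text \<open>
  A first-order Lisp: data are S-expressions over symbols, and a program is a finite list of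
  function bodies, the first one being the main function.  Evaluation is call by value, and
  every evaluation step costs one unit.  A step allocates at most one pair, and only
  symbols and \<open>NilD\<close> can be compared (\<open>EqE\<close>), so up to the names of the symbols, which are the
  atoms, the model is polynomially equivalent to Turing machines.  Programs contain no symbols,
  hence can only copy and compare those of their input.  Variables are de Bruijn indices.
\<close>

datatype 'a data = NilD | Sym 'a | PairD "'a data" "'a data"

datatype expr =
    Var nat
  | NilE
  | PairE expr expr
  | FstE expr
  | SndE expr
  | EqE expr expr
  | IfE expr expr expr
  | LetE expr expr
  | CallE nat "expr list"

type_synonym program = "expr list"

fun data_fst :: "'a data \<Rightarrow> 'a data" where
  "data_fst (PairD x y) = x"
| "data_fst _ = NilD"

fun data_snd :: "'a data \<Rightarrow> 'a data" where
  "data_snd (PairD x y) = y"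
| "data_snd _ = NilD"

fun is_pair :: "'a data \<Rightarrow> bool" where
  "is_pair (PairD x y) = True"
| "is_pair _ = False"

definition enc_bool :: "bool \<Rightarrow> 'a data" where
  "enc_bool b = (if b then PairD NilD NilD else NilD)"

inductive
  run :: "program \<Rightarrow> 'a data list \<Rightarrow> expr \<Rightarrow> 'a data \<Rightarrow> nat \<Rightarrow> bool" and
  runs :: "program \<Rightarrow> 'a data list \<Rightarrow> expr list \<Rightarrow> 'a data list \<Rightarrow> nat \<Rightarrow> bool"
  for prg :: program where
  run_Var: "n < length env \<Longrightarrow> run prg env (Var n) (env ! n) 1"
| run_Nil: "run prg env NilE NilD 1"
| run_Pair: "run prg env e1 x t1 \<Longrightarrow> run prg env e2 y t2
    \<Longrightarrow> run prg env (PairE e1 e2) (PairD x y) (Suc (t1 + t2))"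
| run_Fst: "run prg env e x t \<Longrightarrow> run prg env (FstE e) (data_fst x) (Suc t)"
| run_Snd: "run prg env e x t \<Longrightarrow> run prg env (SndE e) (data_snd x) (Suc t)"
| run_Eq: "run prg env e1 x t1 \<Longrightarrow> run prg env e2 y t2
    \<Longrightarrow> run prg env (EqE e1 e2) (enc_bool (\<not> is_pair x \<and> x = y)) (Suc (t1 + t2))"
| run_If_True: "run prg env e x t1 \<Longrightarrow> is_pair x \<Longrightarrow> run prg env e1 y t2
    \<Longrightarrow> run prg env (IfE e e1 e2) y (Suc (t1 + t2))"
| run_If_False: "run prg env e x t1 \<Longrightarrow> \<not> is_pair x \<Longrightarrow> run prg env e2 y t2
    \<Longrightarrow> run prg env (IfE e e1 e2) y (Suc (t1 + t2))"
| run_Let: "run prg env e1 x t1 \<Longrightarrow> run prg (x # env) e2 y t2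
    \<Longrightarrow> run prg env (LetE e1 e2) y (Suc (t1 + t2))"
| run_Call: "runs prg env es xs t1 \<Longrightarrow> i < length prg \<Longrightarrow> run prg xs (prg ! i) y t2
    \<Longrightarrow> run prg env (CallE i es) y (Suc (t1 + t2))"
| runs_Nil: "runs prg env [] [] 0"
| runs_Cons: "run prg env e x t1 \<Longrightarrow> runs prg env es xs t2
    \<Longrightarrow> runs prg env (e # es) (x # xs) (t1 + t2)"

inductive_cases run_elims:
  "run prg env (Var n) x t"
  "run prg env NilE x t"
  "run prg env (PairE e1 e2) x t"
  "run prg env (FstE e) x t"
  "run prg env (SndE e) x t"
  "run prg env (EqE e1 e2) x t"
  "run prg env (IfE e e1 e2) x t"
  "run prg env (LetE e1 e2) x t"
  "run prg env (CallE i es) x t"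
  "runs prg env [] xs t"
  "runs prg env (e # es) xs t"

lemma run_deterministic:
  "run prg env e x t \<Longrightarrow> run prg env e x' t' \<Longrightarrow> x' = x \<and> t' = t"
  "runs prg env es xs s \<Longrightarrow> runs prg env es xs' s' \<Longrightarrow> xs' = xs \<and> s' = s"
proof (induction arbitrary: x' t' and xs' s' rule: run_runs.inducts)
qed (erule run_elims; (blast | metis | simp))+

definition outputs_within :: "program \<Rightarrow> 'a data list \<Rightarrow> 'a data \<Rightarrow> nat \<Rightarrow> bool" where
  "outputs_within prg args out bound \<longleftrightarrow>
     prg \<noteq> [] \<and> (\<exists>t \<le> bound. run prg args (hd prg) out t)"

section \<open>Encoding of inputs and outputs\<close>

definition enc_list :: "'a data list \<Rightarrow> 'a data" where
  "enc_list xs = foldr PairD xs NilD"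

definition enc_unary :: "nat \<Rightarrow> 'a data" where
  "enc_unary n = enc_list (replicate n NilD)"

fun bits :: "nat \<Rightarrow> bool list" where
  "bits n = (if n = 0 then [] else odd n # bits (n div 2))"

declare bits.simps [simp del]

definition enc_binary :: "nat \<Rightarrow> 'a data" where
  "enc_binary n = enc_list (map enc_bool (bits n))"

text \<open>
  A DAG is presented, as is usual for circuits, by listing its nodes without repetition, children
  before parents; the root is then the last node.  References to children are positions in
  this list.  Writing positions in unary makes the data at most polynomially longer, as
  they are smaller than the number of nodes.
\<close>

definition dag_listing :: "'a form \<Rightarrow> 'a form list \<Rightarrow> bool" where
  "dag_listing f ns \<longleftrightarrow>
     distinct ns \<and> set ns = subforms f \<and>
     (\<forall>i < length ns. children (ns ! i) \<subseteq> set (take i ns))"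

definition position :: "'a form list \<Rightarrow> 'a form \<Rightarrow> nat" where
  "position ns f = (LEAST i. i < length ns \<and> ns ! i = f)"

definition enc_ref :: "'a form list \<Rightarrow> 'a form \<Rightarrow> 'a data" where
  "enc_ref ns f = enc_unary (position ns f)"

definition enc_refs :: "'a form list \<Rightarrow> 'a form fset \<Rightarrow> 'a data" where
  "enc_refs ns S = enc_list (map enc_unary (sorted_list_of_set (position ns ` fset S)))"

fun enc_node :: "'a form list \<Rightarrow> 'a form \<Rightarrow> 'a data" where
  "enc_node ns (Atom a) = PairD (enc_unary 0) (Sym a)"
| "enc_node ns (Neg f) = PairD (enc_unary 1) (enc_ref ns f)"
| "enc_node ns (And S) = PairD (enc_unary 2) (enc_refs ns S)"
| "enc_node ns (Or S) = PairD (enc_unary 3) (enc_refs ns S)"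
| "enc_node ns (Imp f g) = PairD (enc_unary 4) (PairD (enc_ref ns f) (enc_ref ns g))"
| "enc_node ns (Iff f g) = PairD (enc_unary 5) (PairD (enc_ref ns f) (enc_ref ns g))"

definition enc_dag :: "'a form list \<Rightarrow> 'a data" where
  "enc_dag ns = enc_list (map (enc_node ns) ns)"

definition enc_atoms :: "'a list \<Rightarrow> 'a data" where
  "enc_atoms as = enc_list (map Sym as)"

fun enc_literal :: "'a form \<Rightarrow> 'a data" where
  "enc_literal (Atom a) = PairD (enc_bool True) (Sym a)"
| "enc_literal (Neg (Atom a)) = PairD (enc_bool False) (Sym a)"
| "enc_literal _ = NilD"

definition enc_literals :: "'a form list \<Rightarrow> 'a data" where
  "enc_literals ls = enc_list (map enc_literal ls)"

text \<open>
  A set of conjunctions of literals is presented as a list, without repetition, of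
  repetition-free lists of literals.
\<close>

definition presents_conjunctions :: "'a data \<Rightarrow> 'a form set \<Rightarrow> bool" where
  "presents_conjunctions out E \<longleftrightarrow>
     (\<exists>lss. out = enc_list (map enc_literals lss) \<and>
            (\<forall>ls \<in> set lss. distinct ls \<and> (\<forall>l \<in> set ls. is_literal l)) \<and>
            distinct (map (\<lambda>ls. And (fset_of_list ls)) lss) \<and>
            set (map (\<lambda>ls. And (fset_of_list ls)) lss) = E)"

end

theory Submission
  imports Defs
begin

text \<open>
  If \<open>\<psi>\<close> is reduced with respect to \<open>\<alpha>\<close>, every valuation satisfying the abstraction of \<open>\<psi>\<close> agrees
  on \<open>\<alpha>\<close> with some interpretation of the theory.  Hence all four questions become propositional.

  In a decomposable formula, satisfiability under a partial assignment propagates bottom-up: a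
  conjunction is satisfiable iff its children are.  This decides (a) and, falsifying the literals
  of the clause, (b), where tautological clauses have to be treated apart.  For (c), the number of
  models is taken over all of \<open>\<alpha>\<close> at every node, which makes smoothing unnecessary: disjunctions add
  up, and since the children of a conjunction constrain disjoint sets of atoms, conjoining
  multiplies the counts and divides by \<open>2 ^ |\<alpha>|\<close>, a shift in binary.  For (d), the atoms are
  assigned one by one and unsatisfiable branches are cut; each surviving branch leads to an
  output, so there are at most \<open>1 + 2 |\<alpha>| k\<close> calls for \<open>k\<close> outputs, and \<open>|\<alpha>|\<close> itself is bounded
  by the size of \<open>\<psi>\<close> plus \<open>k\<close> unless \<open>k = 0\<close>, when the first test already fails.
\<close>

section \<open>Weakest preconditions for programs\<close>

text \<open>Evaluation is deterministic, so the existence of one run is total correctness. The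
  postcondition also sees the time, so result and running time are verified together.\<close>

definition wp :: "program \<Rightarrow> 'a data list \<Rightarrow> expr \<Rightarrow> ('a data \<Rightarrow> nat \<Rightarrow> bool) \<Rightarrow> bool" where
  "wp prg env e Q \<longleftrightarrow> (\<exists>x t. run prg env e x t \<and> Q x t)"

definition wps :: "program \<Rightarrow> 'a data list \<Rightarrow> expr list \<Rightarrow> ('a data list \<Rightarrow> nat \<Rightarrow> bool) \<Rightarrow> bool" where
  "wps prg env es Q \<longleftrightarrow> (\<exists>xs t. runs prg env es xs t \<and> Q xs t)"

text \<open>Kept apart from \<open>wp\<close> so that symbolic evaluation of a body stops at calls,
  which are then settled by \<open>computes\<close> facts.\<close>

definition wp_call :: "program \<Rightarrow> nat \<Rightarrow> 'a data list \<Rightarrow> ('a data \<Rightarrow> nat \<Rightarrow> bool) \<Rightarrow> bool" where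
  "wp_call prg i xs Q \<longleftrightarrow> i < length prg \<and> wp prg xs (prg ! i) Q"

definition computes :: "program \<Rightarrow> nat \<Rightarrow> 'a data list \<Rightarrow> 'a data \<Rightarrow> nat \<Rightarrow> bool" where
  "computes prg i xs y B \<longleftrightarrow> wp_call prg i xs (\<lambda>x t. x = y \<and> t \<le> B)"

lemma wp_Var: "wp prg env (Var n) Q \<longleftrightarrow> n < length env \<and> Q (env ! n) 1"
  unfolding wp_def by (auto intro: run_Var[unfolded One_nat_def] elim!: run_elims)

lemma wp_Nil: "wp prg env NilE Q \<longleftrightarrow> Q NilD 1"
  unfolding wp_def by (auto intro: run_Nil[unfolded One_nat_def] elim!: run_elims)

lemma wp_Pair:
  "wp prg env (PairE e1 e2) Q \<longleftrightarrow>
     wp prg env e1 (\<lambda>x t1. wp prg env e2 (\<lambda>y t2. Q (PairD x y) (Suc (t1 + t2))))"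
  unfolding wp_def by (blast intro: run_Pair elim: run_elims)

lemma wp_Fst: "wp prg env (FstE e) Q \<longleftrightarrow> wp prg env e (\<lambda>x t. Q (data_fst x) (Suc t))"
  unfolding wp_def by (blast intro: run_Fst elim: run_elims)

lemma wp_Snd: "wp prg env (SndE e) Q \<longleftrightarrow> wp prg env e (\<lambda>x t. Q (data_snd x) (Suc t))"
  unfolding wp_def by (blast intro: run_Snd elim: run_elims)

lemma wp_Eq:
  "wp prg env (EqE e1 e2) Q \<longleftrightarrow>
     wp prg env e1 (\<lambda>x t1. wp prg env e2 (\<lambda>y t2.
       Q (enc_bool (\<not> is_pair x \<and> x = y)) (Suc (t1 + t2))))"
  unfolding wp_def by (blast intro: run_Eq elim: run_elims)

lemma wp_If:
  "wp prg env (IfE e e1 e2) Q \<longleftrightarrow>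
     wp prg env e (\<lambda>x t1. wp prg env (if is_pair x then e1 else e2) (\<lambda>y t2. Q y (Suc (t1 + t2))))"
proof -
  have "run prg env (IfE e e1 e2) y t \<longleftrightarrow> (\<exists>x t1 t2. run prg env e x t1 \<and>
      run prg env (if is_pair x then e1 else e2) y t2 \<and> t = Suc (t1 + t2))" for y t
  proof
    assume "run prg env (IfE e e1 e2) y t"
    then show "\<exists>x t1 t2. run prg env e x t1 \<and>
        run prg env (if is_pair x then e1 else e2) y t2 \<and> t = Suc (t1 + t2)"
    proof (rule run_elims(7))
      fix x t1 t2
      assume "t = Suc (t1 + t2)" "run prg env e x t1" "is_pair x" "run prg env e1 y t2"
      then show ?thesis by (intro exI[of _ x] exI[of _ t1] exI[of _ t2]) simp
    next
      fix x t1 t2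
      assume "t = Suc (t1 + t2)" "run prg env e x t1" "\<not> is_pair x" "run prg env e2 y t2"
      then show ?thesis by (intro exI[of _ x] exI[of _ t1] exI[of _ t2]) simp
    qed
  next
    assume "\<exists>x t1 t2. run prg env e x t1 \<and>
        run prg env (if is_pair x then e1 else e2) y t2 \<and> t = Suc (t1 + t2)"
    then obtain x t1 t2 where "run prg env e x t1"
        "run prg env (if is_pair x then e1 else e2) y t2" "t = Suc (t1 + t2)"
      by blast
    then show "run prg env (IfE e e1 e2) y t"
      by (cases "is_pair x") (simp_all add: run_If_True run_If_False)
  qed
  then show ?thesis unfolding wp_def by (simp only:) blast
qed

lemma wp_Let:
  "wp prg env (LetE e1 e2) Q \<longleftrightarrow>
     wp prg env e1 (\<lambda>x t1. wp prg (x # env) e2 (\<lambda>y t2. Q y (Suc (t1 + t2))))"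
  unfolding wp_def by (blast intro: run_Let elim: run_elims)

lemma wp_Call:
  "wp prg env (CallE i es) Q \<longleftrightarrow>
     wps prg env es (\<lambda>xs t1. wp_call prg i xs (\<lambda>y t2. Q y (Suc (t1 + t2))))"
  unfolding wp_def wps_def wp_call_def by (blast intro: run_Call elim: run_elims)

lemma wps_Nil: "wps prg env [] Q \<longleftrightarrow> Q [] 0"
  unfolding wps_def by (auto intro: runs_Nil elim: run_elims)

lemma wps_Cons:
  "wps prg env (e # es) Q \<longleftrightarrow>
     wp prg env e (\<lambda>x t1. wps prg env es (\<lambda>xs t2. Q (x # xs) (t1 + t2)))"
  unfolding wp_def wps_def by (blast intro: runs_Cons elim: run_elims)

lemmas wp_simps = wp_Var wp_Nil wp_Pair wp_Fst wp_Snd wp_Eq wp_If wp_Let wp_Call wps_Nil wps_Cons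

text \<open>Consequence rule for calls: the exact time of the callee is left open, so the caller has
  to tolerate every time up to the bound.\<close>

lemma computesD:
  assumes "computes prg i xs y B" "\<And>t. t \<le> B \<Longrightarrow> Q y t"
  shows "wp_call prg i xs Q"
  using assms unfolding computes_def wp_call_def wp_def by blast

lemma computes_mono: "computes prg i xs y B \<Longrightarrow> B \<le> B' \<Longrightarrow> computes prg i xs y B'"
  by (auto simp: computes_def[of _ _ _ _ B'] intro: computesD)

lemma outputs_within_computes:
  "computes prg 0 args out B \<Longrightarrow> outputs_within prg args out B"
  unfolding computes_def wp_call_def wp_def outputs_within_def by (cases prg) auto

section \<open>The programs\<close>

abbreviation TrueE :: expr where "TrueE \<equiv> PairE NilE NilE"

abbreviation NotE :: "expr \<Rightarrow> expr" where "NotE e \<equiv> IfE e NilE TrueE"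

abbreviation XorE :: "expr \<Rightarrow> expr \<Rightarrow> expr" where
  "XorE e e' \<equiv> IfE e (NotE e') (IfE e' TrueE NilE)"

text \<open>
  A call \<open>CallE k\<close> refers to the \<open>k\<close>-th entry of the list \<open>with_main\<close> below; entry \<open>0\<close> is the main
  function.
\<close>

definition nth_body :: expr where
  "nth_body = IfE (Var 1) (CallE 1 [SndE (Var 0), SndE (Var 1)]) (FstE (Var 0))"

definition snoc_body :: expr where
  "snoc_body = IfE (Var 0) (PairE (FstE (Var 0)) (CallE 2 [SndE (Var 0), Var 1]))
     (PairE (Var 1) NilE)"

text \<open>The length of the argument list is the exponent; each element puts one zero bit in front
  of the numeral of 1, least significant bit first.\<close>

definition pow_body :: expr where
  "pow_body = IfE (Var 0) (PairE NilE (CallE 3 [SndE (Var 0)])) (PairE TrueE NilE)"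

text \<open>Ripple-carry addition with the carry in \<open>Var 2\<close>. Reading past the end of
  the shorter numeral gives \<open>NilD\<close>, the bit 0.\<close>

definition add_body :: expr where
  "add_body = IfE (IfE (Var 0) TrueE (Var 1))
     (PairE (XorE (XorE (FstE (Var 0)) (FstE (Var 1))) (Var 2))
       (CallE 4 [SndE (Var 0), SndE (Var 1),
         IfE (FstE (Var 0)) (IfE (FstE (Var 1)) TrueE (Var 2)) (IfE (FstE (Var 1)) (Var 2) NilE)]))
     (IfE (Var 2) (PairE TrueE NilE) NilE)"

text \<open>Innermost, \<open>Var 1\<close> is the product with the halved second factor and
  \<open>Var 0\<close> its double. Zero is the empty numeral, so doubling it must not prepend a
  bit.\<close>

definition mul_body :: expr where
  "mul_body = IfE (Var 1)
     (LetE (CallE 5 [Var 0, SndE (Var 1)])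
       (LetE (IfE (Var 0) (PairE NilE (Var 0)) NilE)
         (IfE (FstE (Var 3)) (CallE 4 [Var 2, Var 0, NilE]) (Var 0))))
     NilE"

definition shift_body :: expr where
  "shift_body = IfE (Var 1) (CallE 6 [SndE (Var 0), SndE (Var 1)]) (Var 0)"

text \<open>\<open>EqE\<close> is false on pairs, and \<open>enc_bool True\<close> is a pair, so
  polarities are compared by branching.\<close>

definition member_body :: expr where
  "member_body = IfE (Var 2)
     (IfE (IfE (Var 0) (FstE (FstE (Var 2))) (NotE (FstE (FstE (Var 2)))))
       (IfE (EqE (Var 1) (SndE (FstE (Var 2)))) TrueE (CallE 7 [Var 0, Var 1, SndE (Var 2)]))
       (CallE 7 [Var 0, Var 1, SndE (Var 2)]))
     NilE"

definition taut_body :: expr where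
  "taut_body = IfE (Var 0)
     (IfE (CallE 7 [NotE (FstE (FstE (Var 0))), SndE (FstE (Var 0)), Var 1]) TrueE
       (CallE 8 [SndE (Var 0), Var 1]))
     NilE"

text \<open>
  From here on a context argument selects the values attached to nodes.  The context
  \<open>PairD NilD N\<close> yields Booleans (satisfiability by a valuation falsifying the literals in \<open>N\<close>);
  the context \<open>PairD (enc_bool True) \<alpha>\<close> yields binary numbers (number of models over \<open>\<alpha>\<close>).
  Where a function distinguishes conjunctions from disjunctions, its first argument is false for the
  former; in \<open>node_body\<close> it is obtained by stripping two units from the node tags 2 and 3.
\<close>

definition lit_body :: expr where
  "lit_body = IfE (FstE (Var 0)) (CallE 3 [SndE (SndE (Var 0))])
     (NotE (CallE 7 [Var 1, Var 2, SndE (Var 0)]))"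

definition unit_body :: expr where
  "unit_body = IfE (Var 0) NilE (IfE (FstE (Var 1)) (CallE 3 [SndE (Var 1)]) TrueE)"

text \<open>When counting, the list of atoms in the context doubles as the exponent of the shift
  after a multiplication.\<close>

definition op_body :: expr where
  "op_body = IfE (FstE (Var 1))
     (IfE (Var 0) (CallE 4 [Var 2, Var 3, NilE]) (CallE 6 [CallE 5 [Var 2, Var 3], SndE (Var 1)]))
     (IfE (Var 0) (IfE (Var 2) (Var 2) (Var 3)) (IfE (Var 2) (Var 3) NilE))"

definition fold_body :: expr where
  "fold_body = IfE (Var 3)
     (CallE 12 [Var 0, Var 1, Var 2, SndE (Var 3),
       CallE 11 [Var 0, Var 1, Var 4, CallE 1 [Var 2, FstE (Var 3)]]])
     (Var 4)"

text \<open>Satisfiability of an atom does not determine that of its negation. For a negated atom,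
  therefore, the symbol is fetched from the DAG instead of the value of the child from the
  table.\<close>

definition node_body :: expr where
  "node_body = IfE (FstE (Var 3))
     (IfE (SndE (FstE (Var 3)))
       (CallE 12 [SndE (SndE (FstE (Var 3))), Var 0, Var 2, SndE (Var 3),
         CallE 10 [SndE (SndE (FstE (Var 3))), Var 0]])
       (CallE 9 [Var 0, NilE, SndE (CallE 1 [Var 1, SndE (Var 3)])]))
     (CallE 9 [Var 0, TrueE, SndE (Var 3)])"

text \<open>Values are appended at the end of the table, so that a reference to a node is also the
  index of its value.\<close>

definition eval_body :: expr where
  "eval_body = IfE (Var 3)
     (LetE (CallE 13 [Var 0, Var 1, Var 2, FstE (Var 3)])
       (CallE 14 [Var 1, Var 2, CallE 2 [Var 3, Var 0], SndE (Var 4), Var 0]))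
     (Var 4)"

text \<open>\<open>Var 2\<close> holds the chosen literals and \<open>Var 3\<close> their
  complements, the context of the satisfiability test. The outputs of the false branch become the
  accumulator of the true branch, which avoids appending lists.\<close>

definition enum_body :: expr where
  "enum_body = IfE (CallE 14 [PairE NilE (Var 3), Var 0, NilE, Var 0, NilE])
     (IfE (Var 1)
       (CallE 15 [Var 0, SndE (Var 1), PairE (PairE TrueE (FstE (Var 1))) (Var 2),
         PairE (PairE NilE (FstE (Var 1))) (Var 3),
         CallE 15 [Var 0, SndE (Var 1), PairE (PairE NilE (FstE (Var 1))) (Var 2),
           PairE (PairE TrueE (FstE (Var 1))) (Var 3), Var 4]])
       (PairE (Var 2) (Var 4)))
     (Var 4)"

definition with_main :: "expr \<Rightarrow> program" where
  "with_main e = [e, nth_body, snoc_body, pow_body, add_body, mul_body, shift_body, member_body,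
     taut_body, lit_body, unit_body, op_body, fold_body, node_body, eval_body, enum_body]"

lemma wp_call_with_main:
  "wp_call (with_main e) 0 = (\<lambda>xs. wp (with_main e) xs e)"
  "wp_call (with_main e) 1 = (\<lambda>xs. wp (with_main e) xs nth_body)"
  "wp_call (with_main e) 2 = (\<lambda>xs. wp (with_main e) xs snoc_body)"
  "wp_call (with_main e) 3 = (\<lambda>xs. wp (with_main e) xs pow_body)"
  "wp_call (with_main e) 4 = (\<lambda>xs. wp (with_main e) xs add_body)"
  "wp_call (with_main e) 5 = (\<lambda>xs. wp (with_main e) xs mul_body)"
  "wp_call (with_main e) 6 = (\<lambda>xs. wp (with_main e) xs shift_body)"
  "wp_call (with_main e) 7 = (\<lambda>xs. wp (with_main e) xs member_body)"
  "wp_call (with_main e) 8 = (\<lambda>xs. wp (with_main e) xs taut_body)"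
  "wp_call (with_main e) 9 = (\<lambda>xs. wp (with_main e) xs lit_body)"
  "wp_call (with_main e) 10 = (\<lambda>xs. wp (with_main e) xs unit_body)"
  "wp_call (with_main e) 11 = (\<lambda>xs. wp (with_main e) xs op_body)"
  "wp_call (with_main e) 12 = (\<lambda>xs. wp (with_main e) xs fold_body)"
  "wp_call (with_main e) 13 = (\<lambda>xs. wp (with_main e) xs node_body)"
  "wp_call (with_main e) 14 = (\<lambda>xs. wp (with_main e) xs eval_body)"
  "wp_call (with_main e) 15 = (\<lambda>xs. wp (with_main e) xs enum_body)"
  by (simp_all add: fun_eq_iff wp_call_def with_main_def)

lemma computesI:
  "wp_call (with_main e) i xs = wp (with_main e) xs body \<Longrightarrow>
   wp (with_main e) xs body (\<lambda>x t. x = y \<and> t \<le> B) \<Longrightarrow> computes (with_main e) i xs y B"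
  by (simp add: computes_def)

lemmas computes_main = wp_call_with_main(1)[THEN fun_cong, THEN computesI]
lemmas computes_nth = wp_call_with_main(2)[THEN fun_cong, THEN computesI]
lemmas computes_snoc = wp_call_with_main(3)[THEN fun_cong, THEN computesI]
lemmas computes_pow = wp_call_with_main(4)[THEN fun_cong, THEN computesI]
lemmas computes_add = wp_call_with_main(5)[THEN fun_cong, THEN computesI]
lemmas computes_mul = wp_call_with_main(6)[THEN fun_cong, THEN computesI]
lemmas computes_shift = wp_call_with_main(7)[THEN fun_cong, THEN computesI]
lemmas computes_member = wp_call_with_main(8)[THEN fun_cong, THEN computesI]
lemmas computes_taut = wp_call_with_main(9)[THEN fun_cong, THEN computesI]
lemmas computes_lit = wp_call_with_main(10)[THEN fun_cong, THEN computesI]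
lemmas computes_unit = wp_call_with_main(11)[THEN fun_cong, THEN computesI]
lemmas computes_op = wp_call_with_main(12)[THEN fun_cong, THEN computesI]
lemmas computes_fold = wp_call_with_main(13)[THEN fun_cong, THEN computesI]
lemmas computes_node = wp_call_with_main(14)[THEN fun_cong, THEN computesI]
lemmas computes_eval = wp_call_with_main(15)[THEN fun_cong, THEN computesI]
lemmas computes_enum = wp_call_with_main(16)[THEN fun_cong, THEN computesI]

section \<open>Lists and binary arithmetic\<close>

lemma enc_list_simps [simp]:
  "enc_list [] = NilD" "enc_list (x # xs) = PairD x (enc_list xs)"
  by (simp_all add: enc_list_def)

lemma enc_unary_simps [simp]:
  "enc_unary 0 = NilD" "enc_unary (Suc n) = PairD NilD (enc_unary n)"
  by (simp_all add: enc_unary_def)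

lemma is_pair_enc_bool [simp]: "is_pair (enc_bool b) = b"
  by (simp add: enc_bool_def)

lemma enc_bool_eqs: "enc_bool True = PairD NilD NilD" "enc_bool False = NilD"
  by (simp_all add: enc_bool_def)

text \<open>As in the time bounds below, the constant is generous: it only has to cover one
  execution of the body.\<close>

lemma nth_correct:
  "i < length xs \<Longrightarrow> computes (with_main e) 1 [enc_list xs, enc_unary i] (xs ! i) (10 * Suc i)"
proof (induction i arbitrary: xs)
  case 0
  then obtain y ys where "xs = y # ys" by (cases xs) auto
  then show ?case by (intro computes_nth) (simp add: nth_body_def wp_simps)
next
  case (Suc i)
  then obtain y ys where xs: "xs = y # ys" by (cases xs) auto
  with Suc have "computes (with_main e) 1 [enc_list ys, enc_unary i] (ys ! i) (10 * Suc i)" by simp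
  then show ?case
    by (intro computes_nth) (auto simp add: xs nth_body_def wp_simps elim!: computesD)
qed

lemma snoc_correct:
  "computes (with_main e) 2 [enc_list xs, y] (enc_list (xs @ [y])) (20 * Suc (length xs))"
proof (induction xs)
  case Nil
  show ?case by (intro computes_snoc) (simp add: snoc_body_def wp_simps)
next
  case (Cons x xs)
  then show ?case
    by (intro computes_snoc) (auto simp add: snoc_body_def wp_simps elim!: computesD)
qed

lemma bits_0 [simp]: "bits 0 = []"
  by (simp add: bits.simps)

lemma bits_pos: "n > 0 \<Longrightarrow> bits n = odd n # bits (n div 2)"
  by (subst bits.simps) simp

lemma enc_binary_0 [simp]: "enc_binary 0 = NilD"
  by (simp add: enc_binary_def)

lemma enc_binary_pos:
  "n > 0 \<Longrightarrow> enc_binary n = PairD (enc_bool (odd n)) (enc_binary (n div 2))"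
  by (simp add: enc_binary_def bits_pos)

lemma enc_binary_double: "n > 0 \<Longrightarrow> enc_binary (2 * n) = PairD NilD (enc_binary n)"
  by (simp add: enc_binary_pos enc_bool_eqs)

lemma is_pair_enc_binary [simp]: "is_pair (enc_binary n) \<longleftrightarrow> n > 0"
  by (cases "n = 0") (simp_all add: enc_binary_pos)

text \<open>Also true for 0: components of \<open>NilD\<close> are \<open>NilD\<close>, which
  encodes both the bit false and the number 0.\<close>

lemma data_fst_enc_binary [simp]: "data_fst (enc_binary n) = enc_bool (odd n)"
  by (cases "n = 0") (simp_all add: enc_binary_pos enc_bool_eqs)

lemma data_snd_enc_binary [simp]: "data_snd (enc_binary n) = enc_binary (n div 2)"
  by (cases "n = 0") (simp_all add: enc_binary_pos)

lemma pow_correct: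
  "computes (with_main e) 3 [enc_list xs] (enc_binary (2 ^ length xs)) (20 * Suc (length xs))"
proof (induction xs)
  case Nil
  show ?case by (intro computes_pow) (simp add: pow_body_def wp_simps enc_binary_pos enc_bool_eqs)
next
  case (Cons x xs)
  then show ?case
    by (intro computes_pow)
      (auto simp add: pow_body_def wp_simps enc_binary_pos enc_bool_eqs elim!: computesD)
qed

lemma shift_correct:
  "computes (with_main e) 6 [enc_binary n, enc_list xs] (enc_binary (n div 2 ^ length xs))
     (20 * Suc (length xs))"
proof (induction xs arbitrary: n)
  case Nil
  show ?case by (intro computes_shift) (simp add: shift_body_def wp_simps)
next
  case (Cons x xs)
  from Cons[of "n div 2"] show ?case
    by (intro computes_shift) (auto simp add: shift_body_def wp_simps div_mult2_eq elim!: computesD)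
qed

text \<open>The induction is on a common bound \<open>k\<close> for the lengths, because the
  recursion stops only when both numerals are exhausted.\<close>

lemma add_correct:
  "x < 2 ^ k \<Longrightarrow> y < 2 ^ k \<Longrightarrow>
   computes (with_main e) 4 [enc_binary x, enc_binary y, enc_bool c :: 'a data]
     (enc_binary (x + y + of_bool c)) (70 * Suc k)"
proof (induction k arbitrary: x y c)
  case 0
  then show ?case
    by (intro computes_add) (auto simp add: add_body_def wp_simps enc_binary_pos enc_bool_eqs)
next
  case (Suc k)
  show ?case
  proof (cases "x = 0 \<and> y = 0")
    case True
    then show ?thesis
      by (intro computes_add) (auto simp add: add_body_def wp_simps enc_binary_pos enc_bool_eqs)
  next
    case False
    \<comment> \<open>The outgoing carry is the majority of the two low bits and the incoming
      carry.\<close>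
    let ?c = "(odd x \<and> odd y) \<or> (c \<and> (odd x \<or> odd y))"
    have IH: "computes (with_main e) 4
        [enc_binary (x div 2), enc_binary (y div 2), enc_bool ?c :: 'a data]
        (enc_binary (x div 2 + y div 2 + of_bool ?c)) (70 * Suc k)"
      using Suc.prems by (intro Suc.IH) auto
    have s: "enc_binary (x + y + of_bool c) =
        PairD (enc_bool (odd (x + y + of_bool c))) (enc_binary (x div 2 + y div 2 + of_bool ?c))"
    proof -
      have "(x + y + of_bool c) div 2 = x div 2 + y div 2 + of_bool ?c"
        by (cases c; cases "odd x"; cases "odd y") (auto elim!: oddE evenE)
      with False show ?thesis by (simp add: enc_binary_pos)
    qed
    show ?thesis unfolding s using IH False
      by (cases c; cases "odd x"; cases "odd y"; intro computes_add)
        (auto simp add: add_body_def wp_simps enc_bool_eqs elim!: computesD)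
  qed
qed

text \<open>At most \<open>k\<close> rounds each add numbers of at most \<open>j + k\<close> bits,
  whence the quadratic bound.\<close>

lemma mul_correct:
  "x < 2 ^ j \<Longrightarrow> y < 2 ^ k \<Longrightarrow>
   computes (with_main e) 5 [enc_binary x, enc_binary y :: 'a data] (enc_binary (x * y))
     (Suc k * (100 * Suc (j + k)))"
proof (induction k arbitrary: y)
  case 0
  then show ?case
    by (intro computes_mul) (auto simp add: mul_body_def wp_simps)
next
  case (Suc k)
  show ?case
  proof (cases "y = 0")
    case True
    then show ?thesis by (intro computes_mul) (auto simp add: mul_body_def wp_simps)
  next
    case False
    define r where "r = x * (y div 2)"
    have IH: "computes (with_main e) 5 [enc_binary x, enc_binary (y div 2) :: 'a data]
        (enc_binary r) (Suc k * (100 * Suc (j + k)))"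
      unfolding r_def using Suc.prems by (intro Suc.IH) auto
    have "y div 2 < 2 ^ k" using Suc.prems by auto
    \<comment> \<open>The double of the partial product must fit into \<open>j + Suc k\<close> bits
      for the addition.\<close>
    with Suc.prems have "r < 2 ^ j * 2 ^ k" unfolding r_def by (intro mult_strict_mono) auto
    then have "2 * r < 2 ^ (j + Suc k)" by (simp add: power_add)
    moreover have "x < 2 ^ (j + Suc k)"
      by (rule less_le_trans[OF Suc.prems(1)]) (rule power_increasing; simp)
    ultimately have "computes (with_main e) 4
        [enc_binary x, enc_binary (2 * r), enc_bool False :: 'a data]
        (enc_binary (x + 2 * r + of_bool False)) (70 * Suc (j + Suc k))"
      by (intro add_correct) auto
    then have add: "computes (with_main e) 4 [enc_binary x, enc_binary (2 * r), NilD :: 'a data]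
        (enc_binary (x + 2 * r)) (70 * Suc (j + Suc k))"
      by (simp add: enc_bool_eqs)
    have xy: "x * y = (if odd y then x + 2 * r else 2 * r)"
      unfolding r_def by (cases "odd y") (auto elim!: evenE oddE simp: algebra_simps)
    \<comment> \<open>Opaque names keep the remaining arithmetic linear; in \<open>time\<close> the
      summand 30 covers the steps outside the two calls.\<close>
    define c1 c2 c3 where "c1 = Suc k * (100 * Suc (j + k))" and "c2 = 70 * Suc (j + Suc k)"
      and "c3 = Suc (Suc k) * (100 * Suc (j + Suc k))"
    have time: "c1 + c2 + 30 \<le> c3" unfolding c1_def c2_def c3_def by (simp add: algebra_simps)
    note IH = IH[folded c1_def] and add = add[folded c2_def]
    have add0: "computes (with_main e) 4 [enc_binary x, NilD, NilD :: 'a data]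
        (enc_binary x) c2" if "r = 0"
      using add that by simp
    have "wp (with_main e) [enc_binary x, enc_binary y :: 'a data] mul_body
        (\<lambda>z t. z = enc_binary (if odd y then x + 2 * r else 2 * r) \<and> t \<le> c3)"
      using False time
      by (cases "r = 0"; cases "odd y")
        (auto simp: mul_body_def wp_simps simp flip: enc_binary_double
          intro!: computesD[OF IH] computesD[OF add] computesD[OF add0])
    then show ?thesis unfolding c3_def[symmetric] xy by (rule computes_mul)
  qed
qed

section \<open>Literals and clauses\<close>

definition literal :: "bool \<Rightarrow> 'a \<Rightarrow> 'a form" where
  "literal p a = (if p then Atom a else Neg (Atom a))"

lemma literal_eq_iff [simp]: "literal p a = literal q b \<longleftrightarrow> p = q \<and> a = b"
  by (simp add: literal_def)

lemma is_literal_iff: "is_literal l \<longleftrightarrow> (\<exists>p a. l = literal p a)"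
  by (cases l rule: is_literal.cases) (auto simp: literal_def split: if_splits)

lemma is_literalE:
  assumes "is_literal l"
  obtains p a where "l = literal p a"
  using assms unfolding is_literal_iff by blast

lemma sat_literal [simp]: "sat v (literal p a) \<longleftrightarrow> v a = p"
  by (simp add: literal_def)

lemma atoms_literal [simp]: "atoms (literal p a) = {a}"
  by (simp add: literal_def)

lemma enc_literal_literal [simp]: "enc_literal (literal p a) = PairD (enc_bool p) (Sym a)"
  by (simp add: literal_def)

lemma enc_literals_simps [simp]:
  "enc_literals [] = NilD" "enc_literals (l # ls) = PairD (enc_literal l) (enc_literals ls)"
  by (simp_all add: enc_literals_def)

lemma member_correct:
  assumes "\<forall>l \<in> set ls. is_literal l"
  shows "computes (with_main e) 7 [enc_bool p, Sym a, enc_literals ls]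
    (enc_bool (literal p a \<in> set ls)) (60 * Suc (length ls))"
  using assms
proof (induction ls)
  case Nil
  show ?case by (intro computes_member) (simp add: member_body_def wp_simps enc_bool_eqs)
next
  case (Cons l ls)
  then obtain q b where l: "l = literal q b" by (auto simp: is_literal_iff)
  have IH: "computes (with_main e) 7 [enc_bool p, Sym a, enc_literals ls]
      (enc_bool (literal p a \<in> set ls)) (60 * Suc (length ls))"
    using Cons by simp
  show ?case
    using IH l
    by (cases p; cases q; cases "a = b"; intro computes_member)
      (auto simp add: member_body_def wp_simps enc_bool_eqs elim!: computesD)
qed

text \<open>The scanned list is generalised to \<open>rs\<close>, since the recursion shortens it
  while the list searched for complements stays fixed.\<close>

lemma taut_correct:
  assumes "\<forall>l \<in> set ls. is_literal l" "\<forall>l \<in> set rs. is_literal l"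
  shows "computes (with_main e) 8 [enc_literals rs, enc_literals ls]
    (enc_bool (\<exists>p a. literal p a \<in> set rs \<and> literal (\<not> p) a \<in> set ls))
    (Suc (length rs) * (60 * Suc (length ls) + 60))"
  using assms(2)
proof (induction rs)
  case Nil
  show ?case by (intro computes_taut) (simp add: taut_body_def wp_simps enc_bool_eqs)
next
  case (Cons l rs)
  then obtain q b where l: "l = literal q b" by (auto simp: is_literal_iff)
  define r where "r \<longleftrightarrow> (\<exists>p a. literal p a \<in> set rs \<and> literal (\<not> p) a \<in> set ls)"
  define m where "m \<longleftrightarrow> literal (\<not> q) b \<in> set ls"
  have IH: "computes (with_main e) 8 [enc_literals rs, enc_literals ls] (enc_bool r)
      (Suc (length rs) * (60 * Suc (length ls) + 60))"
    unfolding r_def using Cons by simp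
  have mem: "computes (with_main e) 7 [enc_bool (\<not> q), Sym b, enc_literals ls] (enc_bool m)
      (60 * Suc (length ls))"
    unfolding m_def by (rule member_correct[OF assms(1)])
  have eq: "(\<exists>p a. literal p a \<in> set (l # rs) \<and> literal (\<not> p) a \<in> set ls) \<longleftrightarrow> m \<or> r"
    unfolding r_def m_def l by auto
  show ?case
    unfolding eq using IH mem l
    by (cases q; cases m; intro computes_taut)
      (auto simp add: taut_body_def wp_simps enc_bool_eqs elim!: computesD)
qed

section \<open>Bottom-up evaluation of a DAG\<close>

definition junction :: "bool \<Rightarrow> 'a form fset \<Rightarrow> 'a form" where
  "junction d S = (if d then Or S else And S)"

section \<open>Listings of a DAG, children before parents\<close>

lemma self_in_subforms: "f \<in> subforms f"
  by (cases f) auto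

lemma parent_in_subforms:
  "g \<in> subforms f \<Longrightarrow> g \<noteq> f \<Longrightarrow> \<exists>h \<in> subforms f. g \<in> children h"
proof (induction f)
  case (And S)
  then obtain f where f: "f |\<in>| S" "g \<in> subforms f" by auto
  show ?case
  proof (cases "g = f")
    case True
    with f show ?thesis by auto
  next
    case False
    with And.IH[OF f(1) f(2)] f show ?thesis by fastforce
  qed
next
  case (Or S)
  then obtain f where f: "f |\<in>| S" "g \<in> subforms f" by auto
  show ?case
  proof (cases "g = f")
    case True
    with f show ?thesis by auto
  next
    case False
    with Or.IH[OF f(1) f(2)] f show ?thesis by fastforce
  qed
next
  case (Neg f)
  then show ?case by (cases "g = f") auto
next
  case (Imp f1 f2)
  then show ?case by (cases "g = f1 \<or> g = f2") auto
next
  case (Iff f1 f2)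
  then show ?case by (cases "g = f1 \<or> g = f2") auto
qed simp

text \<open>A last node other than the root would be a child of some node and hence occur strictly
  before it; without repetitions it could then not be last.\<close>

lemma dag_listing_last:
  assumes "dag_listing f ns"
  shows "ns \<noteq> [] \<and> last ns = f"
proof -
  have ns: "distinct ns" "set ns = subforms f"
    and ch: "\<And>i. i < length ns \<Longrightarrow> children (ns ! i) \<subseteq> set (take i ns)"
    using assms by (auto simp: dag_listing_def)
  have ne: "ns \<noteq> []" using ns(2) self_in_subforms[of f] by auto
  moreover have "last ns = f"
  proof (rule ccontr)
    assume "last ns \<noteq> f"
    moreover have "last ns \<in> subforms f" using ne ns(2) last_in_set by blast
    ultimately obtain h where "h \<in> subforms f" "last ns \<in> children h"
      using parent_in_subforms by blast
    then obtain i where i: "i < length ns" "last ns \<in> set (take i ns)"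
      using ch ns(2) by (metis in_set_conv_nth subsetD)
    then obtain j where "j < i" "ns ! j = last ns"
      by (auto simp: in_set_conv_nth)
    moreover have "last ns = ns ! (length ns - 1)" using ne by (rule last_conv_nth)
    ultimately have "j = length ns - 1" using ns(1) ne i(1) by (simp add: nth_eq_iff_index_eq)
    with \<open>j < i\<close> i(1) show False by simp
  qed
  ultimately show ?thesis ..
qed

lemma dag_listing_length: "dag_listing f ns \<Longrightarrow> length ns = dag_size f"
  unfolding dag_listing_def dag_size_def using distinct_card by metis

lemma position_in_take:
  assumes "distinct ns" "g \<in> set (take i ns)" "i \<le> length ns"
  shows "position ns g < i \<and> ns ! position ns g = g"
proof -
  obtain j where j: "j < i" "j < length ns" "ns ! j = g"
    using assms(2,3) by (auto simp: in_set_conv_nth)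
  then have "position ns g = j"
    unfolding position_def using assms(1) by (intro Least_equality) (auto simp: nth_eq_iff_index_eq)
  with j show ?thesis by simp
qed

text \<open>\<open>s\<close> is the number of nodes and \<open>K\<close> bounds one operation on
  values. A node has at most \<open>s\<close> children, each costing a lookup of
  \<open>10 * Suc s\<close> and one operation.\<close>

definition node_bound :: "nat \<Rightarrow> nat \<Rightarrow> nat" where
  "node_bound s K = Suc s * (10 * Suc s + K + 40) + 10 * Suc s + K + 60"

definition eval_bound :: "nat \<Rightarrow> nat \<Rightarrow> nat" where
  "eval_bound s K = Suc s * (node_bound s K + 20 * Suc s + 60)"

text \<open>
  The accumulator of the loop over the children of a node is the value of the junction of the
  children visited so far, which need not be a node of the DAG.
\<close>

locale node_values =
  fixes e :: expr and c :: "'a data" and \<psi> :: "'a form" and ns :: "'a form list"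
    and val :: "'a form \<Rightarrow> 'a data" and K :: nat
  assumes listing: "dag_listing \<psi> ns" and nnf: "nnf \<psi>"
    and unit_correct: "computes (with_main e) 10 [enc_bool d, c] (val (junction d {||})) K"
    and op_correct: "junction d S \<in> subforms \<psi> \<Longrightarrow> finsert g F |\<subseteq>| S \<Longrightarrow> g |\<notin>| F \<Longrightarrow>
      computes (with_main e) 11 [enc_bool d, c, val (junction d F), val g]
        (val (junction d (finsert g F))) K"
    and literal_correct: "literal p a \<in> subforms \<psi> \<Longrightarrow>
      computes (with_main e) 9 [c, enc_bool p, Sym a] (val (literal p a)) K"
begin

text \<open>The references still to come name children outside \<open>F\<close>; this invariant
  yields the freshness that \<open>op_correct\<close> demands.\<close>

lemma fold_correct:
  assumes "junction d S \<in> subforms \<psi>" "k \<le> length ns"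
  assumes "distinct rs" "set rs \<subseteq> {..<k}" "(!) ns ` set rs \<subseteq> fset S" "F |\<subseteq>| S"
    "(!) ns ` set rs \<inter> fset F = {}"
  shows "computes (with_main e) 12
    [enc_bool d, c, enc_list (map val (take k ns)), enc_list (map enc_unary rs), val (junction d F)]
    (val (junction d (F |\<union>| fset_of_list (map ((!) ns) rs))))
    (Suc (length rs) * (10 * Suc (length ns) + K + 40))"
  using assms(3-)
proof (induction rs arbitrary: F)
  case Nil
  show ?case by (intro computes_fold) (simp add: fold_body_def wp_simps)
next
  case (Cons r rs)
  have r: "r < k" "r < length ns" using Cons.prems(2) assms(2) by auto
  have r_S: "ns ! r |\<in>| S" and F_S: "F |\<subseteq>| S" and r_F: "ns ! r |\<notin>| F"
    using Cons.prems(3-5) by auto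
  have dist: "distinct ns" using listing by (simp add: dag_listing_def)
  have "computes (with_main e) 1 [enc_list (map val (take k ns)), enc_unary r]
      (map val (take k ns) ! r) (10 * Suc r)"
    using r by (intro nth_correct) simp
  then have nth: "computes (with_main e) 1 [enc_list (map val (take k ns)), enc_unary r]
      (val (ns ! r)) (10 * Suc (length ns))"
    using r by - (rule computes_mono[of _ _ _ _ "10 * Suc r"], simp_all)
  have op: "computes (with_main e) 11 [enc_bool d, c, val (junction d F), val (ns ! r)]
        (val (junction d (finsert (ns ! r) F))) K"
    using r_S F_S r_F by (intro op_correct[OF assms(1)]) auto
  have "ns ! r \<noteq> ns ! q" if "q \<in> set rs" for q
  proof -
    have "q \<noteq> r" "q < length ns" using that Cons.prems(1,2) assms(2) by auto
    with r dist show ?thesis by (simp add: nth_eq_iff_index_eq)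
  qed
  then have disj: "(!) ns ` set rs \<inter> fset (finsert (ns ! r) F) = {}"
    using Cons.prems(5) by auto
  have IH: "computes (with_main e) 12
    [enc_bool d, c, enc_list (map val (take k ns)), enc_list (map enc_unary rs),
      val (junction d (finsert (ns ! r) F))]
    (val (junction d (finsert (ns ! r) F |\<union>| fset_of_list (map ((!) ns) rs))))
    (Suc (length rs) * (10 * Suc (length ns) + K + 40))"
    using Cons.prems(1-3) r_S F_S disj by (intro Cons.IH) auto
  have eq: "F |\<union>| fset_of_list (map ((!) ns) (r # rs)) =
      finsert (ns ! r) F |\<union>| fset_of_list (map ((!) ns) rs)"
    by auto
  show ?case unfolding eq
    by (intro computes_fold)
      (auto simp: fold_body_def wp_simps
        intro!: computesD[OF nth[unfolded One_nat_def]] computesD[OF op] computesD[OF IH])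
qed

lemma refs_correct:
  assumes i: "i < length ns" "ns ! i = junction d S"
  shows "computes (with_main e) 12
    [enc_bool d, c, enc_list (map val (take i ns)), enc_refs ns S, val (junction d {||})]
    (val (junction d S)) (Suc (length ns) * (10 * Suc (length ns) + K + 40))"
proof -
  have dist: "distinct ns" and sub: "set ns = subforms \<psi>"
    and ch: "children (ns ! i) \<subseteq> set (take i ns)"
    using listing i(1) unfolding dag_listing_def by blast+
  have "fset S \<subseteq> set (take i ns)" using ch i(2) by (auto simp: junction_def split: if_splits)
  then have pos: "position ns g < i \<and> ns ! position ns g = g" if "g |\<in>| S" for g
    using position_in_take[OF dist] i(1) that by (meson in_mono less_imp_le)
  define rs where "rs = sorted_list_of_set (position ns ` fset S)"
  have set_rs: "set rs = position ns ` fset S" "distinct rs" by (simp_all add: rs_def)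
  have im: "(!) ns ` set rs = fset S" unfolding set_rs using pos by force
  have "set rs \<subseteq> {..<i}" using set_rs pos by auto
  \<comment> \<open>Distinct references below \<open>i\<close> limit the rounds of the loop to the
    number of earlier nodes.\<close>
  moreover from this have "length rs \<le> i"
    using set_rs(2) by (metis card_lessThan card_mono distinct_card finite_lessThan)
  ultimately have "computes (with_main e) 12
    [enc_bool d, c, enc_list (map val (take i ns)), enc_list (map enc_unary rs),
      val (junction d {||})]
    (val (junction d ({||} |\<union>| fset_of_list (map ((!) ns) rs))))
    (Suc (length rs) * (10 * Suc (length ns) + K + 40))"
    using im i set_rs(2) sub by (intro fold_correct[of d S]) (auto simp flip: i(2))
  moreover have "fset_of_list (map ((!) ns) rs) = S"
    using im by (auto simp: fset_of_list.rep_eq fset_eq_iff)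
  ultimately show ?thesis
    using \<open>length rs \<le> i\<close> i(1)
    by - (rule computes_mono[of _ _ _ _ "Suc (length rs) * (10 * Suc (length ns) + K + 40)"],
      simp_all add: enc_refs_def rs_def del: mult_Suc)
qed

lemma node_correct:
  assumes i: "i < length ns"
  shows "computes (with_main e) 13
    [c, enc_dag ns, enc_list (map val (take i ns)), enc_node ns (ns ! i)] (val (ns ! i))
    (node_bound (length ns) K)"
proof -
  have dist: "distinct ns" and sub: "set ns = subforms \<psi>"
    and ch: "children (ns ! i) \<subseteq> set (take i ns)"
    using listing i(1) unfolding dag_listing_def by blast+
  have in_sub: "ns ! i \<in> subforms \<psi>" using i sub nth_mem by blast
  then consider (lit) p a where "ns ! i = literal p a" | (jun) d S where "ns ! i = junction d S"
    using nnf unfolding nnf_def by (fastforce simp: is_literal_iff junction_def)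
  then show ?thesis
  proof cases
    case lit
    have lc: "computes (with_main e) 9 [c, enc_bool p, Sym a] (val (literal p a)) K"
      using in_sub lit by (intro literal_correct) simp
    show ?thesis
    proof (cases p)
      case True
      with lc lit show ?thesis
        by (intro computes_node)
          (auto simp: node_body_def node_bound_def wp_simps literal_def enc_bool_eqs elim!: computesD)
    next
      case False
      let ?j = "position ns (Atom a)"
      have j: "?j < i" "ns ! ?j = Atom a"
        using position_in_take[OF dist, of "Atom a" i] ch i lit False
        by (auto simp: literal_def)
      have "computes (with_main e) 1 [enc_dag ns, enc_unary ?j]
          (map (enc_node ns) ns ! ?j) (10 * Suc ?j)"
        unfolding enc_dag_def using i j by (intro nth_correct) simp
      then have "computes (with_main e) 1 [enc_dag ns, enc_unary ?j]
          (PairD NilD (Sym a)) (10 * Suc (length ns))"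
        using i j by - (rule computes_mono[of _ _ _ _ "10 * Suc ?j"], simp_all)
      with False lc lit show ?thesis
        by (intro computes_node)
          (auto simp: node_body_def node_bound_def wp_simps literal_def enc_bool_eqs enc_ref_def
             elim!: computesD)
    qed
  next
    case jun
    \<comment> \<open>In unary, the tags 2 and 3 are two units followed by nothing or by one more
      unit, which is exactly \<open>enc_bool d\<close>.\<close>
    have enc: "enc_node ns (junction d S) = PairD (PairD NilD (PairD NilD (enc_bool d))) (enc_refs ns S)"
      by (simp add: junction_def eval_nat_numeral enc_bool_eqs)
    show ?thesis unfolding jun enc
      by (intro computes_node)
        (auto simp: node_body_def node_bound_def wp_simps
          intro!: computesD[OF unit_correct] computesD[OF refs_correct[OF i jun]])
  qed
qed

text \<open>Loop invariant: the table holds the values of the first \<open>i\<close> nodes;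
  \<open>z\<close> stands for the value computed last and is returned once the nodes run
  out.\<close>

lemma eval_from_correct:
  assumes "i \<le> length ns"
  shows "computes (with_main e) 14
    [c, enc_dag ns, enc_list (map val (take i ns)), enc_list (map (enc_node ns) (drop i ns)), z]
    (if i = length ns then z else val (last ns))
    (Suc (length ns - i) * (node_bound (length ns) K + 20 * Suc (length ns) + 60))"
  using assms
proof (induction "length ns - i" arbitrary: i z)
  case 0
  then show ?case by (intro computes_eval) (simp add: eval_body_def wp_simps)
next
  case (Suc n)
  then have i: "i < length ns" by simp
  define v where "v = val (ns ! i)"
  have node: "computes (with_main e) 13
      [c, enc_dag ns, enc_list (map val (take i ns)), enc_node ns (ns ! i)] v
      (node_bound (length ns) K)"
    unfolding v_def by (rule node_correct[OF i])
  have tk: "map val (take i ns) @ [v] = map val (take (Suc i) ns)"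
    using i by (simp add: take_Suc_conv_app_nth v_def)
  have "computes (with_main e) 2 [enc_list (map val (take i ns)), v]
      (enc_list (map val (take (Suc i) ns))) (20 * Suc (length (map val (take i ns))))"
    unfolding tk[symmetric] by (rule snoc_correct)
  then have snoc: "computes (with_main e) 2 [enc_list (map val (take i ns)), v]
      (enc_list (map val (take (Suc i) ns))) (20 * Suc (length ns))"
    by (rule computes_mono) simp
  \<comment> \<open>In the last round the value just computed is that of the last node, so both
    cases of the invariant agree.\<close>
  have res: "(if Suc i = length ns then v else val (last ns)) = val (last ns)"
  proof -
    have "last ns = ns ! (length ns - 1)" using i by (intro last_conv_nth) auto
    then show ?thesis by (metis v_def diff_Suc_1)
  qed
  have IH: "computes (with_main e) 14
    [c, enc_dag ns, enc_list (map val (take (Suc i) ns)),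
      enc_list (map (enc_node ns) (drop (Suc i) ns)), v] (val (last ns))
    (Suc n * (node_bound (length ns) K + 20 * Suc (length ns) + 60))"
  proof -
    have n: "n = length ns - Suc i" using Suc.hyps(2) by simp
    show ?thesis using Suc.hyps(1)[OF n, of v] i unfolding res n by (simp del: mult_Suc)
  qed
  have dr: "enc_list (map (enc_node ns) (drop i ns)) =
      PairD (enc_node ns (ns ! i)) (enc_list (map (enc_node ns) (drop (Suc i) ns)))"
    using i by (simp flip: Cons_nth_drop_Suc)
  show ?case unfolding dr using i Suc.hyps(2)[symmetric]
    by (intro computes_eval)
      (auto simp: eval_body_def wp_simps
        intro!: computesD[OF node] computesD[OF snoc] computesD[OF IH])
qed

text \<open>The last listed node is the root; as the listing is nonempty, the dummy initial value
  \<open>NilD\<close> is never returned.\<close>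

lemma eval_correct:
  "computes (with_main e) 14 [c, enc_dag ns, NilD, enc_dag ns, NilD] (val \<psi>)
     (eval_bound (length ns) K)"
  using eval_from_correct[of 0 NilD] dag_listing_last[OF listing]
  by (simp add: enc_dag_def eval_bound_def)

end

section \<open>Satisfiability and counting\<close>

lemma sat_cong: "(\<And>a. a \<in> atoms f \<Longrightarrow> v a = w a) \<Longrightarrow> sat v f \<longleftrightarrow> sat w f"
  by (induction f) (simp; blast?)+

lemma atoms_And_disjoint:
  assumes "decomposable f" "And S \<in> subforms f" "finsert g F |\<subseteq>| S" "g |\<notin>| F"
  shows "atoms (And F) \<inter> atoms g = {}"
proof -
  have "atoms h \<inter> atoms g = {}" if "h |\<in>| F" for h
  proof -
    have "h |\<in>| S" "g |\<in>| S" "h \<noteq> g" using assms(3,4) that by auto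
    then show ?thesis using assms(1,2) unfolding decomposable_def by blast
  qed
  then show ?thesis by auto
qed

text \<open>A partial assignment is represented by the literals it falsifies, so that a clause can
  itself serve as the assignment when its entailment is tested.\<close>

definition sat_avoiding :: "'a form list \<Rightarrow> 'a form \<Rightarrow> bool" where
  "sat_avoiding N f \<longleftrightarrow> (\<exists>v. (\<forall>l \<in> set N. \<not> sat v l) \<and> sat v f)"

definition consistent :: "'a form list \<Rightarrow> bool" where
  "consistent N \<longleftrightarrow> (\<forall>l \<in> set N. is_literal l) \<and>
     (\<forall>a. literal True a \<notin> set N \<or> literal False a \<notin> set N)"

text \<open>Two witnesses can be glued, one on the atoms of \<open>g\<close>, the other elsewhere: a
  literal in \<open>N\<close> has a single atom and is falsified by whichever witness governs
  it.\<close>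

lemma sat_avoiding_And:
  assumes "\<forall>l \<in> set N. is_literal l" "atoms (And F) \<inter> atoms g = {}"
  shows "sat_avoiding N (And (finsert g F)) \<longleftrightarrow> sat_avoiding N (And F) \<and> sat_avoiding N g"
proof
  assume "sat_avoiding N (And F) \<and> sat_avoiding N g"
  then obtain v w where v: "\<forall>l \<in> set N. \<not> sat v l" "sat v (And F)"
    and w: "\<forall>l \<in> set N. \<not> sat w l" "sat w g"
    by (auto simp: sat_avoiding_def)
  define u where "u a = (if a \<in> atoms g then w a else v a)" for a
  have "sat u (And F) \<longleftrightarrow> sat v (And F)"
    using assms(2) by (intro sat_cong) (auto simp: u_def)
  moreover have "sat u g \<longleftrightarrow> sat w g" by (intro sat_cong) (auto simp: u_def)
  moreover have "\<not> sat u l" if "l \<in> set N" for l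
  proof -
    have "is_literal l" using assms(1) \<open>l \<in> set N\<close> by blast
    then obtain p a where "l = literal p a" by (rule is_literalE)
    then show ?thesis using v(1) w(1) that by (cases "a \<in> atoms g") (auto simp: u_def)
  qed
  ultimately show "sat_avoiding N (And (finsert g F))"
    using v w unfolding sat_avoiding_def by auto
qed (auto simp: sat_avoiding_def)

lemma sat_avoiding_Or:
  "sat_avoiding N (Or (finsert g F)) \<longleftrightarrow> sat_avoiding N (Or F) \<or> sat_avoiding N g"
  by (auto simp: sat_avoiding_def)

text \<open>Making exactly those atoms true whose negation is in \<open>N\<close> falsifies all of
  \<open>N\<close>, as there is no complementary pair.\<close>

lemma sat_avoiding_True:
  assumes "consistent N"
  shows "sat_avoiding N (And {||})"
proof -
  have "\<not> sat (\<lambda>a. literal False a \<in> set N) l" if "l \<in> set N" for l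
  proof -
    have "is_literal l" using assms \<open>l \<in> set N\<close> unfolding consistent_def by blast
    then obtain p a where "l = literal p a" by (rule is_literalE)
    with that assms show ?thesis by (cases p) (auto simp: consistent_def)
  qed
  then show ?thesis unfolding sat_avoiding_def by auto
qed

lemma sat_avoiding_literal:
  assumes "consistent N"
  shows "sat_avoiding N (literal p a) \<longleftrightarrow> literal p a \<notin> set N"
proof
  assume "literal p a \<notin> set N"
  \<comment> \<open>The valuation falsifying \<open>N\<close>, overridden at \<open>a\<close>: a
    literal of \<open>N\<close> on \<open>a\<close> can only be the complement of
    \<open>literal p a\<close> and stays false.\<close>
  define v where "v b = (if b = a then p else literal False b \<in> set N)" for b
  have "\<not> sat v l" if "l \<in> set N" for l
  proof -
    have "is_literal l" using assms \<open>l \<in> set N\<close> unfolding consistent_def by blast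
    then obtain q b where l: "l = literal q b" by (rule is_literalE)
    with that assms \<open>literal p a \<notin> set N\<close> show ?thesis
      by (cases q; cases p; cases "b = a") (auto simp: consistent_def v_def)
  qed
  moreover have "sat v (literal p a)" by (simp add: v_def)
  ultimately show "sat_avoiding N (literal p a)" unfolding sat_avoiding_def by blast
qed (auto simp: sat_avoiding_def)

lemma op_bool_correct:
  "computes (with_main e) 11 [enc_bool d, PairD NilD z, enc_bool b, enc_bool b']
     (enc_bool (if d then b \<or> b' else b \<and> b')) 60"
  by (cases d; cases b; intro computes_op) (simp_all add: op_body_def wp_simps enc_bool_eqs)

lemma sat_avoiding_node_values:
  assumes "d_DNNF \<psi>" "dag_listing \<psi> ns" "consistent N"
  shows "node_values e (PairD NilD (enc_literals N)) \<psi> ns (\<lambda>f. enc_bool (sat_avoiding N f))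
    (60 * Suc (length N) + 60)"
proof
  show "dag_listing \<psi> ns" "nnf \<psi>" using assms by (simp_all add: d_DNNF_def)
  fix d
  have "sat_avoiding N (junction d {||}) \<longleftrightarrow> \<not> d"
    using sat_avoiding_True[OF assms(3)]
    by (cases d) (simp_all add: junction_def, simp add: sat_avoiding_def)
  then show "computes (with_main e) 10 [enc_bool d, PairD NilD (enc_literals N)]
      (enc_bool (sat_avoiding N (junction d {||}))) (60 * Suc (length N) + 60)"
    by (cases d; intro computes_unit) (simp_all add: unit_body_def wp_simps enc_bool_eqs)
next
  fix d S g F
  assume S: "junction d S \<in> subforms \<psi>" "finsert g F |\<subseteq>| S" "g |\<notin>| F"
  have "sat_avoiding N (junction d (finsert g F)) \<longleftrightarrow>
      (if d then sat_avoiding N (junction d F) \<or> sat_avoiding N g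
       else sat_avoiding N (junction d F) \<and> sat_avoiding N g)"
  proof (cases d)
    case True
    then show ?thesis by (simp add: junction_def sat_avoiding_Or)
  next
    case False
    have "atoms (And F) \<inter> atoms g = {}"
      using assms(1) S False
      by (intro atoms_And_disjoint[of \<psi> S]) (simp_all add: d_DNNF_def junction_def)
    then have "sat_avoiding N (And (finsert g F)) \<longleftrightarrow> sat_avoiding N (And F) \<and> sat_avoiding N g"
      using assms(3) by (intro sat_avoiding_And) (simp_all add: consistent_def)
    with False show ?thesis by (simp only: junction_def if_False)
  qed
  then show "computes (with_main e) 11 [enc_bool d, PairD NilD (enc_literals N),
      enc_bool (sat_avoiding N (junction d F)), enc_bool (sat_avoiding N g)]
      (enc_bool (sat_avoiding N (junction d (finsert g F)))) (60 * Suc (length N) + 60)"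
    by (simp only:) (rule computes_mono[OF op_bool_correct], simp)
next
  fix p a
  have lits: "\<forall>l \<in> set N. is_literal l" using assms(3) by (simp add: consistent_def)
  show "computes (with_main e) 9 [PairD NilD (enc_literals N), enc_bool p, Sym a]
      (enc_bool (sat_avoiding N (literal p a))) (60 * Suc (length N) + 60)"
    unfolding sat_avoiding_literal[OF assms(3)]
    using member_correct[OF lits, of e p a]
    by (cases "literal p a \<in> set N"; intro computes_lit)
      (auto simp: lit_body_def wp_simps enc_bool_eqs elim!: computesD)
qed

definition check_bound :: "nat \<Rightarrow> nat \<Rightarrow> nat" where
  "check_bound s n = eval_bound s (60 * Suc n + 60)"

lemma check_correct:
  assumes "d_DNNF \<psi>" "dag_listing \<psi> ns" "consistent N"
  shows "computes (with_main e) 14 [PairD NilD (enc_literals N), enc_dag ns, NilD, enc_dag ns, NilD]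
    (enc_bool (sat_avoiding N \<psi>)) (check_bound (dag_size \<psi>) (length N))"
  using node_values.eval_correct[OF sat_avoiding_node_values[OF assms, of e]]
  unfolding check_bound_def dag_listing_length[OF assms(2)] .

section \<open>Model counts over the fixed set \<open>\<alpha>\<close>\<close>

definition models :: "'a set \<Rightarrow> 'a form \<Rightarrow> 'a set set" where
  "models \<alpha> f = {X. X \<subseteq> \<alpha> \<and> sat (\<lambda>a. a \<in> X) f}"

lemma finite_models [simp]: "finite \<alpha> \<Longrightarrow> finite (models \<alpha> f)"
  by (rule finite_subset[of _ "Pow \<alpha>"]) (auto simp: models_def)

lemma card_models_le: "finite \<alpha> \<Longrightarrow> card (models \<alpha> f) \<le> 2 ^ card \<alpha>"
  by (subst card_Pow[symmetric], assumption) (intro card_mono; auto simp: models_def)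

lemma card_models_And:
  assumes "finite \<alpha>" "atoms (And F) \<inter> atoms g = {}"
  shows "card (models \<alpha> (And (finsert g F))) * 2 ^ card \<alpha> =
    card (models \<alpha> (And F)) * card (models \<alpha> g)"
proof -
  \<comment> \<open>Exchanging the atoms of \<open>g\<close> between two valuations turns a model of both together with an
    arbitrary valuation into a pair of models.\<close>
  define swap where "swap = (\<lambda>(X, Y). ((X - atoms g) \<union> (Y \<inter> atoms g), (Y - atoms g) \<union> (X \<inter> atoms g)))"
  have inv: "swap (swap Z) = Z" for Z by (cases Z) (auto simp: swap_def)
  have F: "sat (\<lambda>a. a \<in> fst (swap Z)) (And F) \<longleftrightarrow> sat (\<lambda>a. a \<in> fst Z) (And F)" for Z
    using assms(2) by (intro sat_cong; cases Z) (auto simp: swap_def)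
  have g: "sat (\<lambda>a. a \<in> fst (swap Z)) g \<longleftrightarrow> sat (\<lambda>a. a \<in> snd Z) g"
    "sat (\<lambda>a. a \<in> snd (swap Z)) g \<longleftrightarrow> sat (\<lambda>a. a \<in> fst Z) g" for Z
    by (intro sat_cong; cases Z; auto simp: swap_def)+
  have sub: "fst (swap Z) \<subseteq> \<alpha> \<and> snd (swap Z) \<subseteq> \<alpha>" if "fst Z \<subseteq> \<alpha>" "snd Z \<subseteq> \<alpha>" for Z
    using that by (cases Z) (auto simp: swap_def)
  have "bij_betw swap (models \<alpha> (And (finsert g F)) \<times> Pow \<alpha>) (models \<alpha> (And F) \<times> models \<alpha> g)"
  proof (rule bij_betw_byWitness[where f' = swap])
    show "swap ` (models \<alpha> (And (finsert g F)) \<times> Pow \<alpha>) \<subseteq> models \<alpha> (And F) \<times> models \<alpha> g"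
    proof (rule image_subsetI)
      fix Z assume Z: "Z \<in> models \<alpha> (And (finsert g F)) \<times> Pow \<alpha>"
      then have "sat (\<lambda>a. a \<in> fst Z) (And F)" "sat (\<lambda>a. a \<in> fst Z) g"
        "fst Z \<subseteq> \<alpha>" "snd Z \<subseteq> \<alpha>"
        by (auto simp: models_def)
      then show "swap Z \<in> models \<alpha> (And F) \<times> models \<alpha> g"
        using F[of Z] g(2)[of Z] sub[of Z] unfolding models_def mem_Times_iff by blast
    qed
    show "swap ` (models \<alpha> (And F) \<times> models \<alpha> g) \<subseteq> models \<alpha> (And (finsert g F)) \<times> Pow \<alpha>"
    proof (rule image_subsetI)
      fix Z assume "Z \<in> models \<alpha> (And F) \<times> models \<alpha> g"
      then have "sat (\<lambda>a. a \<in> fst Z) (And F)" "sat (\<lambda>a. a \<in> snd Z) g"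
        "fst Z \<subseteq> \<alpha>" "snd Z \<subseteq> \<alpha>"
        by (auto simp: models_def)
      then have "sat (\<lambda>a. a \<in> fst (swap Z)) (And F)" "sat (\<lambda>a. a \<in> fst (swap Z)) g"
        "fst (swap Z) \<subseteq> \<alpha> \<and> snd (swap Z) \<subseteq> \<alpha>"
        using F[of Z] g(1)[of Z] sub[of Z] by blast+
      then show "swap Z \<in> models \<alpha> (And (finsert g F)) \<times> Pow \<alpha>"
        by (simp add: models_def mem_Times_iff)
    qed
  qed (simp_all add: inv)
  from bij_betw_same_card[OF this] show ?thesis
    using assms(1) by (simp add: card_cartesian_product card_Pow)
qed

lemma card_models_Or:
  assumes "finite \<alpha>" "\<And>h. h |\<in>| F \<Longrightarrow> \<not> (\<exists>v. sat v g \<and> sat v h)"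
  shows "card (models \<alpha> (Or (finsert g F))) = card (models \<alpha> (Or F)) + card (models \<alpha> g)"
proof -
  have "models \<alpha> (Or (finsert g F)) = models \<alpha> (Or F) \<union> models \<alpha> g"
    by (auto simp: models_def)
  moreover have "models \<alpha> (Or F) \<inter> models \<alpha> g = {}"
    using assms(2) by (auto simp: models_def)
  ultimately show ?thesis using assms(1) by (simp add: card_Un_disjoint)
qed

lemma card_models_literal:
  assumes "finite \<alpha>" "a \<in> \<alpha>"
  shows "card (models \<alpha> (literal p a)) = 2 ^ (card \<alpha> - 1)"
proof -
  have card: "card (Pow (\<alpha> - {a})) = 2 ^ (card \<alpha> - 1)"
    using assms by (simp add: card_Pow)
  show ?thesis
  proof (cases p)
    case True
    have "models \<alpha> (literal p a) = insert a ` Pow (\<alpha> - {a})"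
    proof (intro equalityI subsetI)
      fix X assume "X \<in> models \<alpha> (literal p a)"
      then have "X = insert a (X - {a})" "X - {a} \<in> Pow (\<alpha> - {a})"
        using True by (auto simp: models_def)
      then show "X \<in> insert a ` Pow (\<alpha> - {a})" by (rule image_eqI)
    qed (use assms(2) True in \<open>auto simp: models_def\<close>)
    moreover have "inj_on (insert a) (Pow (\<alpha> - {a}))" by (auto simp: inj_on_def)
    ultimately show ?thesis using card by (simp add: card_image)
  next
    case False
    then have "models \<alpha> (literal p a) = Pow (\<alpha> - {a})" by (auto simp: models_def)
    then show ?thesis using card by simp
  qed
qed

text \<open>The first summand is the bound of \<open>mul_correct\<close> for two numbers of
  \<open>n + 1\<close> bits; the others cover the shift, additions, powers of two and
  overhead.\<close>

definition arith_bound :: "nat \<Rightarrow> nat" where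
  "arith_bound n = Suc (Suc n) * (100 * Suc (Suc n + Suc n)) + 100 * Suc (Suc n) + 60"

lemma atoms_subform_subset: "g \<in> subforms f \<Longrightarrow> atoms g \<subseteq> atoms f"
  by (induction f) auto

lemma count_node_values:
  assumes "d_DNNF \<psi>" "dag_listing \<psi> ns" "distinct as" "atoms \<psi> \<subseteq> set as"
  shows "node_values e (PairD (enc_bool True) (enc_atoms as)) \<psi> ns
    (\<lambda>f. enc_binary (card (models (set as) f))) (arith_bound (length as))"
proof
  show "dag_listing \<psi> ns" "nnf \<psi>" using assms by (simp_all add: d_DNNF_def)
  let ?c = "PairD (enc_bool True) (enc_atoms as)"
  have card: "card (set as) = length as" using assms(3) by (rule distinct_card)
  {
    fix d
    have "card (models (set as) (junction d {||})) = (if d then 0 else 2 ^ length as)"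
    proof -
      have "models (set as) (And {||}) = Pow (set as)" "models (set as) (Or {||}) = {}"
        by (auto simp: models_def)
      then show ?thesis by (simp add: junction_def card_Pow card)
    qed
    then show "computes (with_main e) 10 [enc_bool d, ?c]
        (enc_binary (card (models (set as) (junction d {||})))) (arith_bound (length as))"
      using pow_correct[of e "map Sym as"]
      by (intro computes_unit)
        (auto simp: unit_body_def wp_simps enc_atoms_def arith_bound_def elim!: computesD)
  }
  {
    fix d S g F
    assume S: "junction d S \<in> subforms \<psi>" "finsert g F |\<subseteq>| S" "g |\<notin>| F"
    define n x y where "n = length as" and "x = card (models (set as) (junction d F))"
      and "y = card (models (set as) g)"
    \<comment> \<open>A count may equal \<open>2 ^ n\<close>, so \<open>n + 1\<close> bits are
      required.\<close>
    have "x \<le> 2 ^ n" "y \<le> 2 ^ n"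
      unfolding n_def x_def y_def card[symmetric] by (simp_all add: card_models_le)
    moreover have "(2::nat) ^ n < 2 ^ Suc n" by simp
    ultimately have xy: "x < 2 ^ Suc n" "y < 2 ^ Suc n" by linarith+
    show "computes (with_main e) 11
        [enc_bool d, ?c, enc_binary (card (models (set as) (junction d F))),
          enc_binary (card (models (set as) g))]
        (enc_binary (card (models (set as) (junction d (finsert g F))))) (arith_bound (length as))"
      unfolding x_def[symmetric] y_def[symmetric] n_def[symmetric]
    proof (cases d)
      case True
      have "\<not> (\<exists>v. sat v g \<and> sat v h)" if "h |\<in>| F" for h
      proof -
        have "Or S \<in> subforms \<psi>" "g |\<in>| S" "h |\<in>| S" "g \<noteq> h"
          using S True that by (auto simp: junction_def)
        then show ?thesis using assms(1) unfolding d_DNNF_def deterministic_def by blast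
      qed
      then have "card (models (set as) (junction d (finsert g F))) = x + y"
        unfolding x_def y_def using True by (simp add: junction_def card_models_Or)
      moreover have "computes (with_main e) 4 [enc_binary x, enc_binary y, NilD :: 'a data]
          (enc_binary (x + y)) (70 * Suc (Suc n))"
        using add_correct[OF xy, of e False] by (simp add: enc_bool_eqs)
      ultimately show "computes (with_main e) 11 [enc_bool d, ?c, enc_binary x, enc_binary y]
          (enc_binary (card (models (set as) (junction d (finsert g F))))) (arith_bound n)"
        using True
        by (intro computes_op) (auto simp: op_body_def wp_simps arith_bound_def elim!: computesD)
    next
      case False
      have disj: "atoms (And F) \<inter> atoms g = {}"
        using assms(1) S False
        by (intro atoms_And_disjoint[of \<psi> S]) (simp_all add: d_DNNF_def junction_def)
      have "card (models (set as) (junction d (finsert g F))) * 2 ^ n = x * y"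
        unfolding x_def y_def n_def card[symmetric] using card_models_And[OF _ disj, of "set as"] False
        by (simp only: junction_def if_False List.finite_set)
      \<comment> \<open>The division is exact, so the shift recovers the count from the
        product.\<close>
      then have "card (models (set as) (junction d (finsert g F))) = x * y div 2 ^ n"
        by (metis nonzero_mult_div_cancel_right power_not_zero zero_neq_numeral)
      moreover have "computes (with_main e) 6 [enc_binary (x * y), enc_atoms as]
          (enc_binary (x * y div 2 ^ n)) (20 * Suc n)"
        using shift_correct[of e "x * y" "map Sym as"] by (simp add: n_def enc_atoms_def)
      moreover note mul_correct[OF xy, of e]
      ultimately show "computes (with_main e) 11 [enc_bool d, ?c, enc_binary x, enc_binary y]
          (enc_binary (card (models (set as) (junction d (finsert g F))))) (arith_bound n)"
        using False
        by (intro computes_op) (auto simp: op_body_def wp_simps arith_bound_def elim!: computesD)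
    qed
  }
  fix p a
  assume "literal p a \<in> subforms \<psi>"
  then have "a \<in> set as" using atoms_subform_subset assms(4) by fastforce
  \<comment> \<open>The tail of the list of atoms has length \<open>|\<alpha>| - 1\<close>, the
    exponent in the number of models of a literal.\<close>
  then obtain b bs where as: "as = b # bs" by (cases as) auto
  have "card (models (set as) (literal p a)) = 2 ^ length bs"
    using card_models_literal[of "set as" a p] \<open>a \<in> set as\<close> card as by simp
  then show "computes (with_main e) 9 [?c, enc_bool p, Sym a]
      (enc_binary (card (models (set as) (literal p a)))) (arith_bound (length as))"
    using pow_correct[of e "map Sym bs"]
    by (intro computes_lit)
      (auto simp: as lit_body_def wp_simps enc_atoms_def arith_bound_def elim!: computesD)
qed

lemma count_correct:
  assumes "d_DNNF \<psi>" "dag_listing \<psi> ns" "distinct as" "atoms \<psi> \<subseteq> set as"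
  shows "computes (with_main e) 14
    [PairD (enc_bool True) (enc_atoms as), enc_dag ns, NilD, enc_dag ns, NilD]
    (enc_binary (card (models (set as) \<psi>))) (eval_bound (dag_size \<psi>) (arith_bound (length as)))"
  using node_values.eval_correct[OF count_node_values[OF assms, of e]]
  unfolding dag_listing_length[OF assms(2)] .

section \<open>Reduction to propositional logic\<close>

text \<open>Canonical form of the total assignments on \<open>set as\<close>, parametrised by
  valuations.\<close>

definition cube :: "'a list \<Rightarrow> ('a \<Rightarrow> bool) \<Rightarrow> 'a form" where
  "cube as v = And (fset_of_list (map (\<lambda>a. literal (v a) a) as))"

lemma sat_cube: "sat w (cube as v) \<longleftrightarrow> (\<forall>a \<in> set as. w a = v a)"
  by (simp add: cube_def fset_of_list.rep_eq)

lemma cube_eq_iff: "cube as v = cube as w \<longleftrightarrow> (\<forall>a \<in> set as. v a = w a)"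
proof
  assume "cube as v = cube as w"
  then show "\<forall>a \<in> set as. v a = w a" using sat_cube[of v as v] sat_cube[of v as w] by simp
next
  assume "\<forall>a \<in> set as. v a = w a"
  then have "map (\<lambda>a. literal (v a) a) as = map (\<lambda>a. literal (w a) a) as" by simp
  then show "cube as v = cube as w" by (simp only: cube_def)
qed

lemma total_assignment_cube: "total_assignment (set as) (cube as v)"
  unfolding total_assignment_def cube_def
  by (intro exI[of _ "fset_of_list (map (\<lambda>a. literal (v a) a) as)"])
    (auto simp: fset_of_list.rep_eq literal_def split: if_splits)

lemma total_assignment_is_cube:
  assumes "total_assignment (set as) \<eta>"
  obtains v where "\<eta> = cube as v"
proof -
  obtain S where S: "\<eta> = And S" "\<forall>l |\<in>| S. is_literal l \<and> atoms l \<subseteq> set as"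
    "\<forall>a \<in> set as. (Atom a |\<in>| S) \<noteq> (Neg (Atom a) |\<in>| S)"
    using assms unfolding total_assignment_def by (elim exE conjE)
  define v where "v a \<longleftrightarrow> Atom a |\<in>| S" for a
  have lit: "literal p a |\<in>| S \<longleftrightarrow> a \<in> set as \<and> p = v a" for p a
    using bspec[OF S(2), of "literal p a"] bspec[OF S(3), of a]
    by (cases p) (auto simp: literal_def v_def)
  have "l |\<in>| S \<longleftrightarrow> l |\<in>| fset_of_list (map (\<lambda>a. literal (v a) a) as)" for l
  proof
    assume l: "l |\<in>| S"
    then have "is_literal l" using S(2) by blast
    then obtain p a where "l = literal p a" by (rule is_literalE)
    with l lit show "l |\<in>| fset_of_list (map (\<lambda>a. literal (v a) a) as)"
      by (auto simp: fset_of_list.rep_eq)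
  next
    assume "l |\<in>| fset_of_list (map (\<lambda>a. literal (v a) a) as)"
    with lit show "l |\<in>| S" by (auto simp: fset_of_list.rep_eq)
  qed
  then have "S = fset_of_list (map (\<lambda>a. literal (v a) a) as)" by (rule fset_eqI)
  with S(1) that show ?thesis by (simp add: cube_def)
qed

lemma cube_entails:
  assumes "atoms f \<subseteq> set as"
  shows "cube as v \<Turnstile>\<^sub>p f \<longleftrightarrow> sat v f"
proof -
  have "sat w f \<longleftrightarrow> sat v f" if "\<forall>a \<in> set as. w a = v a" for w
    using assms that by (intro sat_cong) auto
  then have "sat v f" if "\<forall>w. (\<forall>a \<in> set as. w a = v a) \<longrightarrow> sat w f"
    using spec[OF that, of v] by simp
  with \<open>\<And>w. \<forall>a \<in> set as. w a = v a \<Longrightarrow> sat w f \<longleftrightarrow> sat v f\<close> show ?thesis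
    unfolding prop_entails_def sat_cube by (intro iffI) simp_all
qed

text \<open>Reducedness enters here: an entailing total assignment that is unsatisfiable in the
  theory would lie in \<open>P_assignments\<close>.\<close>

lemma H_assignments_T_reduced:
  assumes "T_reduced T (set as) f" "atoms f \<subseteq> set as"
  shows "H_assignments T (set as) f = {cube as v |v. sat v f}"
proof (intro equalityI subsetI)
  fix \<eta> assume "\<eta> \<in> H_assignments T (set as) f"
  then have "total_assignment (set as) \<eta>" "\<eta> \<Turnstile>\<^sub>p f" by (simp_all add: H_assignments_def)
  moreover from this(1) obtain v where "\<eta> = cube as v" by (rule total_assignment_is_cube)
  ultimately show "\<eta> \<in> {cube as v |v. sat v f}" using cube_entails[OF assms(2)] by blast
next
  fix \<eta> assume "\<eta> \<in> {cube as v |v. sat v f}"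
  then obtain v where v: "\<eta> = cube as v" "sat v f" by blast
  then have "total_assignment (set as) \<eta>" "\<eta> \<Turnstile>\<^sub>p f"
    using cube_entails[OF assms(2)] total_assignment_cube by simp_all
  moreover from this have "T_sat T \<eta>"
    using assms(1) unfolding T_reduced_def P_assignments_def by blast
  ultimately show "\<eta> \<in> H_assignments T (set as) f" by (simp add: H_assignments_def)
qed

text \<open>The cube of a propositional model is satisfiable in the theory, and an interpretation
  satisfying it agrees with the model on all of \<open>\<alpha>\<close>, not only on the atoms of
  \<open>f\<close>.\<close>

lemma T_reduced_realizes:
  assumes "T_reduced T \<alpha> f" "finite \<alpha>" "atoms f \<subseteq> \<alpha>" "sat v f"
  obtains M b where "M \<in> interps T" "\<And>a. a \<in> \<alpha> \<Longrightarrow> truth T M b a = v a"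
proof -
  obtain as where as: "set as = \<alpha>" using assms(2) finite_list by blast
  then have "cube as v \<in> H_assignments T (set as) f"
    using H_assignments_T_reduced[of T as f] assms by blast
  then have "T_sat T (cube as v)" by (simp add: H_assignments_def)
  then show ?thesis using that as unfolding T_sat_def sat_cube by blast
qed

lemma T_sat_iff:
  assumes "T_reduced T \<alpha> f" "finite \<alpha>" "atoms f \<subseteq> \<alpha>"
  shows "T_sat T f \<longleftrightarrow> sat_avoiding [] f"
proof
  assume "sat_avoiding [] f"
  then obtain v where v: "sat v f" by (auto simp: sat_avoiding_def)
  obtain M b where M: "M \<in> interps T" "\<And>a. a \<in> \<alpha> \<Longrightarrow> truth T M b a = v a"
    using T_reduced_realizes[OF assms v] by blast
  then have "sat (truth T M b) f \<longleftrightarrow> sat v f" using assms(3) by (intro sat_cong) blast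
  with v M(1) show "T_sat T f" unfolding T_sat_def by blast
next
  assume "T_sat T f"
  then show "sat_avoiding [] f" unfolding T_sat_def sat_avoiding_def by auto
qed

text \<open>Agreement on all of \<open>\<alpha>\<close> transfers the clause as well as the formula,
  so a valuation refuting the entailment yields an interpretation that does.\<close>

lemma T_entails_clause_iff:
  assumes "T_reduced T \<alpha> f" "finite \<alpha>" "atoms f \<subseteq> \<alpha>" "\<And>l. l \<in> set ls \<Longrightarrow> atoms l \<subseteq> \<alpha>"
  shows "T_entails T f (Or (fset_of_list ls)) \<longleftrightarrow> \<not> sat_avoiding ls f"
proof
  assume ent: "T_entails T f (Or (fset_of_list ls))"
  show "\<not> sat_avoiding ls f"
  proof
    assume "sat_avoiding ls f"
    then obtain v where v: "sat v f" "\<And>l. l \<in> set ls \<Longrightarrow> \<not> sat v l"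
      by (auto simp: sat_avoiding_def)
    obtain M b where M: "M \<in> interps T" "\<And>a. a \<in> \<alpha> \<Longrightarrow> truth T M b a = v a"
      using T_reduced_realizes[OF assms(1-3) v(1)] by blast
    then have cong: "sat (truth T M b) g \<longleftrightarrow> sat v g" if "atoms g \<subseteq> \<alpha>" for g
      using that by (intro sat_cong) blast
    have "sat (truth T M b) (Or (fset_of_list ls))"
      using ent M(1) v(1) cong[OF assms(3)] unfolding T_entails_def by blast
    then obtain l where "l \<in> set ls" "sat (truth T M b) l" by (auto simp: fset_of_list.rep_eq)
    then show False using cong[OF assms(4)] v(2) by blast
  qed
next
  assume "\<not> sat_avoiding ls f"
  then show "T_entails T f (Or (fset_of_list ls))"
    unfolding T_entails_def sat_avoiding_def by (auto simp: fset_of_list.rep_eq)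
qed

lemma card_H_assignments:
  assumes "T_reduced T (set as) f" "atoms f \<subseteq> set as"
  shows "card (H_assignments T (set as) f) = card (models (set as) f)"
proof -
  let ?h = "\<lambda>X. cube as (\<lambda>a. a \<in> X)"
  have "inj_on ?h (models (set as) f)"
  proof (rule inj_onI)
    fix X Y assume "X \<in> models (set as) f" "Y \<in> models (set as) f" "?h X = ?h Y"
    then show "X = Y" unfolding cube_eq_iff models_def by blast
  qed
  moreover have "?h ` models (set as) f = {cube as v |v. sat v f}"
  proof (intro equalityI subsetI)
    fix \<eta> assume "\<eta> \<in> {cube as v |v. sat v f}"
    then obtain v where v: "\<eta> = cube as v" "sat v f" by blast
    \<comment> \<open>Restricting a valuation to \<open>set as\<close> changes neither its cube nor
      the truth of \<open>f\<close>.\<close>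
    define X where "X = {a \<in> set as. v a}"
    have "\<eta> = ?h X" unfolding v(1) cube_eq_iff by (simp add: X_def)
    have "sat (\<lambda>a. a \<in> X) f \<longleftrightarrow> sat v f"
      using assms(2) by (intro sat_cong) (auto simp: X_def)
    then have "X \<in> models (set as) f" using v(2) by (auto simp: models_def X_def)
    with \<open>\<eta> = ?h X\<close> show "\<eta> \<in> ?h ` models (set as) f" by (rule image_eqI)
  qed (auto simp: models_def)
  ultimately show ?thesis
    using H_assignments_T_reduced[OF assms] card_image by fastforce
qed

text \<open>Fix a model on the atoms of \<open>f\<close> and switch on a single other atom:
  different choices give different models.\<close>

lemma card_free_atoms_le_models:
  assumes "finite \<alpha>" "sat v f" "atoms f \<subseteq> \<alpha>"
  shows "card (\<alpha> - atoms f) \<le> card (models \<alpha> f)"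
proof (rule card_inj_on_le)
  let ?h = "\<lambda>b. insert b {a \<in> atoms f. v a}"
  show "inj_on ?h (\<alpha> - atoms f)" by (auto simp: inj_on_def)
  have "sat (\<lambda>a. a \<in> ?h b) f" if "b \<notin> atoms f" for b
  proof -
    have "sat (\<lambda>a. a \<in> ?h b) f \<longleftrightarrow> sat v f" using that by (intro sat_cong) auto
    with assms(2) show ?thesis by simp
  qed
  then show "?h ` (\<alpha> - atoms f) \<subseteq> models \<alpha> f" using assms(3) by (auto simp: models_def)
qed (simp add: assms(1))

lemma Atom_in_subforms: "a \<in> atoms f \<Longrightarrow> Atom a \<in> subforms f"
  by (induction f) auto

lemma card_atoms_le: "card (atoms f) \<le> dag_size f"
  unfolding dag_size_def
  by (rule card_inj_on_le[of Atom]) (auto simp: inj_on_def Atom_in_subforms finite_subforms)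

lemma length_atoms_le:
  assumes "distinct as" "atoms f \<subseteq> set as"
  shows "length as \<le> dag_size f + card (set as - atoms f)"
proof -
  have "card (set as - atoms f) = card (set as) - card (atoms f)"
    using assms(2) by (intro card_Diff_subset) (auto intro: finite_subset)
  then show ?thesis using card_atoms_le[of f] distinct_card[OF assms(1)] by linarith
qed

lemma length_clause_le: "distinct ls \<Longrightarrow> length ls \<le> dag_size (Or (fset_of_list ls))"
proof -
  assume "distinct ls"
  have "set ls \<subseteq> subforms (Or (fset_of_list ls))"
    using self_in_subforms by (fastforce simp: fset_of_list.rep_eq)
  then have "card (set ls) \<le> dag_size (Or (fset_of_list ls))"
    unfolding dag_size_def by (intro card_mono finite_subforms)
  then show ?thesis using distinct_card[OF \<open>distinct ls\<close>] by simp
qed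

section \<open>Enumeration of models\<close>

definition lits :: "('a \<times> bool) list \<Rightarrow> 'a form list" where
  "lits ps = map (\<lambda>(a, p). literal p a) ps"

text \<open>Context for testing a branch: falsifying these literals means agreeing with
  \<open>ps\<close>.\<close>

definition neg_lits :: "('a \<times> bool) list \<Rightarrow> 'a form list" where
  "neg_lits ps = map (\<lambda>(a, p). literal (\<not> p) a) ps"

lemma sat_avoiding_neg_lits:
  "sat_avoiding (neg_lits ps) f \<longleftrightarrow> (\<exists>v. (\<forall>(a, p) \<in> set ps. v a = p) \<and> sat v f)"
proof -
  have "(\<forall>l \<in> set (neg_lits ps). \<not> sat v l) \<longleftrightarrow> (\<forall>(a, p) \<in> set ps. v a = p)" for v
    by (auto simp: neg_lits_def split_beta)
  then show ?thesis unfolding sat_avoiding_def by simp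
qed

lemma consistent_neg_lits:
  assumes "distinct (map fst ps)"
  shows "consistent (neg_lits ps)"
proof -
  have "literal p a \<in> set (neg_lits ps) \<longleftrightarrow> (a, \<not> p) \<in> set ps" for p a
    by (force simp: neg_lits_def)
  moreover have "is_literal l" if "l \<in> set (neg_lits ps)" for l
    using that by (auto simp: neg_lits_def literal_def)
  ultimately show ?thesis
    using eq_key_imp_eq_value[OF assms] unfolding consistent_def by fastforce
qed

primrec enum :: "'a form \<Rightarrow> 'a list \<Rightarrow> ('a \<times> bool) list \<Rightarrow> ('a \<times> bool) list list" where
  "enum f [] ps = (if sat_avoiding (neg_lits ps) f then [ps] else [])"
| "enum f (a # as) ps = (if sat_avoiding (neg_lits ps) f
     then enum f as ((a, True) # ps) @ enum f as ((a, False) # ps) else [])"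

text \<open>Cutting a branch loses nothing, since no model extends it. Atoms are pushed onto the
  front of the branch, hence the reversal.\<close>

lemma set_enum:
  "set (enum f as ps) =
     {map (\<lambda>a. (a, v a)) (rev as) @ ps |v. sat v f \<and> (\<forall>(a, p) \<in> set ps. v a = p)}"
proof (induction as arbitrary: ps)
  case Nil
  show ?case by (auto simp: sat_avoiding_neg_lits)
next
  case (Cons a as)
  let ?R = "\<lambda>as ps. {map (\<lambda>a. (a, v a)) (rev as) @ ps |v. sat v f \<and> (\<forall>(a, p) \<in> set ps. v a = p)}"
  have split: "?R (a # as) ps = ?R as ((a, True) # ps) \<union> ?R as ((a, False) # ps)"
  proof (intro equalityI subsetI)
    fix x assume "x \<in> ?R (a # as) ps"
    then obtain v where v: "x = map (\<lambda>a. (a, v a)) (rev as) @ (a, v a) # ps" "sat v f"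
      "\<forall>(a, p) \<in> set ps. v a = p" by auto
    then have "x \<in> ?R as ((a, v a) # ps)" by auto
    then show "x \<in> ?R as ((a, True) # ps) \<union> ?R as ((a, False) # ps)" by (cases "v a") auto
  next
    fix x assume "x \<in> ?R as ((a, True) # ps) \<union> ?R as ((a, False) # ps)"
    then obtain p where "x \<in> ?R as ((a, p) # ps)" by blast
    then obtain v where v: "x = map (\<lambda>a. (a, v a)) (rev as) @ (a, p) # ps" "sat v f"
      "\<forall>(a, p) \<in> set ps. v a = p" "v a = p" by auto
    then have "x = map (\<lambda>a. (a, v a)) (rev (a # as)) @ ps" by simp
    with v(2,3) show "x \<in> ?R (a # as) ps" by blast
  qed
  show ?case
  proof (cases "sat_avoiding (neg_lits ps) f")
    case True
    then have "set (enum f (a # as) ps) =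
        set (enum f as ((a, True) # ps)) \<union> set (enum f as ((a, False) # ps))"
      by simp
    also have "\<dots> = ?R as ((a, True) # ps) \<union> ?R as ((a, False) # ps)" by (simp only: Cons.IH)
    also have "\<dots> = ?R (a # as) ps" by (rule split[symmetric])
    finally show ?thesis .
  next
    case False
    then have "?R (a # as) ps = {}" unfolding sat_avoiding_neg_lits by blast
    with False show ?thesis by simp
  qed
qed

text \<open>Dropping the later choices from a result recovers the branch it extends, which separates
  the two subtrees.\<close>

lemma distinct_enum: "distinct (enum f as ps)"
proof (induction as arbitrary: ps)
  case (Cons a as)
  have "drop (length as) x = qs" if "x \<in> set (enum f as qs)" for x qs
    using that by (auto simp: set_enum)
  then have "set (enum f as ((a, True) # ps)) \<inter> set (enum f as ((a, False) # ps)) = {}"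
    by (metis disjoint_iff list.inject prod.inject)
  then show ?case using Cons.IH by simp
qed simp

lemma enum_nonempty: "sat_avoiding (neg_lits ps) f \<Longrightarrow> enum f as ps \<noteq> []"
  using set_enum[of f as ps] unfolding sat_avoiding_neg_lits by fastforce

text \<open>\<open>B\<close> covers one call without its recursive calls. It has to cover tests of
  longer branches only if the current one is satisfiable, because otherwise the search stops; thus
  \<open>B\<close> need not grow with \<open>as\<close> when there are no outputs.\<close>

lemma enum_correct:
  assumes "d_DNNF \<psi>" "dag_listing \<psi> ns" "distinct (as @ map fst ps)"
    "\<And>k. k \<le> length ps + (if sat_avoiding (neg_lits ps) \<psi> then length as else 0) \<Longrightarrow>
       check_bound (dag_size \<psi>) k + 80 \<le> B"
  shows "computes (with_main e) 15
    [enc_dag ns, enc_atoms as, enc_literals (lits ps), enc_literals (neg_lits ps), enc_list zs]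
    (enc_list (map (\<lambda>qs. enc_literals (lits qs)) (enum \<psi> as ps) @ zs))
    (B * (1 + 2 * length as * length (enum \<psi> as ps)))"
  using assms(3,4)
proof (induction as arbitrary: ps zs)
  case Nil
  define c where "c = check_bound (dag_size \<psi>) (length (neg_lits ps))"
  have "c + 80 \<le> B" using Nil(2)[of "length ps"] by (simp add: c_def neg_lits_def)
  moreover have "consistent (neg_lits ps)" using Nil by (intro consistent_neg_lits) simp
  note check_correct[OF assms(1,2) this, of e, folded c_def]
  ultimately show ?case
    by (cases "sat_avoiding (neg_lits ps) \<psi>"; intro computes_enum)
      (auto simp: enum_body_def wp_simps enc_atoms_def enc_bool_eqs elim!: computesD)
next
  case (Cons a as)
  define c where "c = check_bound (dag_size \<psi>) (length (neg_lits ps))"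
  have c: "c + 80 \<le> B" using Cons.prems(2)[of "length ps"] by (simp add: c_def neg_lits_def)
  have "consistent (neg_lits ps)" using Cons.prems by (intro consistent_neg_lits) simp
  note check = check_correct[OF assms(1,2) this, of e, folded c_def]
  show ?case
  proof (cases "sat_avoiding (neg_lits ps) \<psi>")
    case False
    with check c show ?thesis
      by (intro computes_enum)
        (auto simp: enum_body_def wp_simps enc_atoms_def enc_bool_eqs elim!: computesD)
  next
    case True
    define l r where "l = enum \<psi> as ((a, True) # ps)" and "r = enum \<psi> as ((a, False) # ps)"
    have dist: "distinct (as @ map fst ((a, p) # ps))" for p using Cons.prems(1) by auto
    \<comment> \<open>Extending a branch moves an atom from the remaining to the chosen ones, so the
      range of tests to be covered does not grow.\<close>
    have bnd: "check_bound (dag_size \<psi>) k + 80 \<le> B"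
      if "k \<le> length ((a, p) # ps) +
        (if sat_avoiding (neg_lits ((a, p) # ps)) \<psi> then length as else 0)" for k p
      using that True by (intro Cons.prems(2)) (auto split: if_splits)
    have IH: "computes (with_main e) 15
      [enc_dag ns, enc_atoms as, PairD (PairD (enc_bool p) (Sym a)) (enc_literals (lits ps)),
        PairD (PairD (enc_bool (\<not> p)) (Sym a)) (enc_literals (neg_lits ps)), enc_list zs]
      (enc_list (map (\<lambda>qs. enc_literals (lits qs)) (enum \<psi> as ((a, p) # ps)) @ zs))
      (B * (1 + 2 * length as * length (enum \<psi> as ((a, p) # ps))))" for p zs
      using Cons.IH[of "(a, p) # ps" zs, OF dist bnd] by (simp add: lits_def neg_lits_def)
    note IHl = IH[of True "map (\<lambda>qs. enc_literals (lits qs)) r @ zs", folded l_def]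
      and IHr = IH[of False zs, folded r_def]
    define tl tr where "tl = B * (1 + 2 * length as * length l)"
      and "tr = B * (1 + 2 * length as * length r)"
    have "enum \<psi> (a # as) ps = l @ r" using True by (simp add: l_def r_def)
    \<comment> \<open>A satisfiable branch has an output, which pays for the present call: for
      \<open>m\<close> outputs with \<open>m \<ge> 1\<close>, \<open>3 + 2 * n * m\<close> is at
      most \<open>1 + 2 * Suc n * m\<close>.\<close>
    moreover from this enum_nonempty[OF True, of "a # as"] have "length l + length r \<ge> 1"
      by (cases l; cases r) auto
    then have "B + tl + tr \<le> B * (1 + 2 * length (a # as) * length (l @ r))"
    proof -
      assume lr: "length l + length r \<ge> 1"
      have "B + tl + tr = B * (3 + 2 * length as * (length l + length r))"
        by (simp add: tl_def tr_def algebra_simps)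
      also have "\<dots> \<le> B * (1 + 2 * length (a # as) * length (l @ r))"
        using lr by (intro mult_le_mono2) (simp add: algebra_simps)
      finally show ?thesis .
    qed
    ultimately show ?thesis
      using check c True IHl[folded tl_def] IHr[folded tr_def]
      by (intro computes_enum)
        (auto simp: enum_body_def wp_simps enc_atoms_def enc_bool_eqs elim!: computesD)
  qed
qed

text \<open>Turning a list into a conjunction forgets the order, but a cube determines the values on
  \<open>as\<close> and these determine the list.\<close>

lemma enum_cubes:
  defines "h \<equiv> \<lambda>qs. And (fset_of_list (lits qs))"
  shows "inj_on h (set (enum f as []))" "h ` set (enum f as []) = {cube as v |v. sat v f}"
proof -
  have en: "set (enum f as []) = {map (\<lambda>a. (a, v a)) (rev as) |v. sat v f}"
    by (simp add: set_enum)
  have h: "h (map (\<lambda>a. (a, v a)) (rev as)) = cube as v" for v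
    by (auto simp: h_def cube_def lits_def fset_eq_iff fset_of_list.rep_eq)
  show "inj_on h (set (enum f as []))"
  proof (rule inj_onI)
    fix x y assume "x \<in> set (enum f as [])" "y \<in> set (enum f as [])" and eq: "h x = h y"
    then obtain v w where xy: "x = map (\<lambda>a. (a, v a)) (rev as)" "y = map (\<lambda>a. (a, w a)) (rev as)"
      unfolding en by blast
    have "cube as v = cube as w" using eq unfolding xy h .
    then show "x = y" unfolding xy cube_eq_iff by simp
  qed
  have "set (enum f as []) = (\<lambda>v. map (\<lambda>a. (a, v a)) (rev as)) ` {v. sat v f}"
    unfolding en by blast
  then show "h ` set (enum f as []) = {cube as v |v. sat v f}"
    by (auto simp: image_image h)
qed

lemma length_enum: "length (enum f as []) = card {cube as v |v. sat v f}"
  using card_image[OF enum_cubes(1), of f as] distinct_card[OF distinct_enum, of f as "[]"]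
  unfolding enum_cubes(2) by simp

lemma presents_conjunctions_enum:
  assumes "distinct as"
  shows "presents_conjunctions
    (enc_list (map (\<lambda>qs. enc_literals (lits qs)) (enum f as []))) {cube as v |v. sat v f}"
proof -
  let ?lss = "map lits (enum f as [])"
  have "distinct (map (\<lambda>ls. And (fset_of_list ls)) ?lss)"
    using distinct_enum[of f as "[]"] enum_cubes(1)[of f as] by (simp add: distinct_map comp_def)
  moreover have "set (map (\<lambda>ls. And (fset_of_list ls)) ?lss) = {cube as v |v. sat v f}"
    using enum_cubes(2)[of f as] by (simp add: image_image)
  moreover have "distinct ls \<and> (\<forall>l \<in> set ls. is_literal l)" if ls: "ls \<in> set ?lss" for ls
  proof -
    obtain v where "ls = lits (map (\<lambda>a. (a, v a)) (rev as))" using ls by (auto simp: set_enum)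
    then have "ls = map (\<lambda>a. literal (v a) a) (rev as)" by (simp add: lits_def)
    then show ?thesis using assms by (auto simp: distinct_map inj_on_def literal_def)
  qed
  ultimately show ?thesis
    unfolding presents_conjunctions_def by (intro exI[of _ ?lss]) (simp add: comp_def)
qed

section \<open>Polynomial bounds\<close>

lemma eval_bound_mono: "s \<le> s' \<Longrightarrow> K \<le> K' \<Longrightarrow> eval_bound s K \<le> eval_bound s' K'"
  unfolding eval_bound_def node_bound_def by (intro mult_le_mono add_le_mono) auto

lemma check_bound_mono: "s \<le> s' \<Longrightarrow> n \<le> n' \<Longrightarrow> check_bound s n \<le> check_bound s' n'"
  unfolding check_bound_def by (rule eval_bound_mono) auto

lemma arith_bound_mono: "n \<le> n' \<Longrightarrow> arith_bound n \<le> arith_bound n'"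
  unfolding arith_bound_def by (intro mult_le_mono add_le_mono) auto

text \<open>Time bounds are composed as functions; the closure properties supply an actual
  polynomial at the end.\<close>

definition is_polynomial :: "(nat \<Rightarrow> nat) \<Rightarrow> bool" where
  "is_polynomial f \<longleftrightarrow> (\<exists>p. \<forall>n. f n = poly p n)"

lemma is_polynomial_const: "is_polynomial (\<lambda>_. c)"
  unfolding is_polynomial_def by (intro exI[of _ "[:c:]"]) simp

lemma is_polynomial_id: "is_polynomial (\<lambda>n. n)"
  unfolding is_polynomial_def by (intro exI[of _ "[:0, 1:]"]) simp

lemma is_polynomial_add:
  "is_polynomial f \<Longrightarrow> is_polynomial g \<Longrightarrow> is_polynomial (\<lambda>n. f n + g n)"
  unfolding is_polynomial_def by (metis poly_add)

lemma is_polynomial_mult: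
  "is_polynomial f \<Longrightarrow> is_polynomial g \<Longrightarrow> is_polynomial (\<lambda>n. f n * g n)"
  unfolding is_polynomial_def by (metis poly_mult)

lemma is_polynomial_Suc: "is_polynomial f \<Longrightarrow> is_polynomial (\<lambda>n. Suc (f n))"
  using is_polynomial_add[OF _ is_polynomial_const, of f 1] by simp

lemmas is_polynomial_intros =
  is_polynomial_const is_polynomial_id is_polynomial_add is_polynomial_mult is_polynomial_Suc

lemma is_polynomial_eval_bound:
  "is_polynomial f \<Longrightarrow> is_polynomial g \<Longrightarrow> is_polynomial (\<lambda>n. eval_bound (f n) (g n))"
  unfolding eval_bound_def node_bound_def by (intro is_polynomial_intros)

lemma is_polynomial_check_bound: "is_polynomial (\<lambda>n. check_bound n n)"
  unfolding check_bound_def by (intro is_polynomial_eval_bound is_polynomial_intros)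

lemma is_polynomial_arith_bound: "is_polynomial arith_bound"
  unfolding arith_bound_def by (intro is_polynomial_intros)

section \<open>Programs and polynomial bounds for the four questions\<close>

lemma consistent_Nil: "consistent []"
  by (simp add: consistent_def)

lemma T_sat_program:
  "\<exists>prg p. \<forall>(\<psi> :: ('t, 'b) atom form) \<alpha> ns.
     d_DNNF \<psi> \<and> finite \<alpha> \<and> atoms \<psi> \<subseteq> \<alpha> \<and> T_reduced T \<alpha> \<psi> \<and> dag_listing \<psi> ns \<longrightarrow>
     outputs_within prg [enc_dag ns] (enc_bool (T_sat T \<psi>)) (poly p (dag_size \<psi>))"
proof -
  have "is_polynomial (\<lambda>n. check_bound n n + 30)"
    by (intro is_polynomial_intros is_polynomial_check_bound)
  then obtain p where p: "\<And>n. poly p n = check_bound n n + 30"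
    unfolding is_polynomial_def by metis
  \<comment> \<open>\<open>TrueE\<close> evaluates to a pair of two \<open>NilD\<close>: here it is
    the Boolean context with an empty list of falsified literals.\<close>
  let ?main = "CallE 14 [TrueE, Var 0, NilE, Var 0, NilE]"
  have "computes (with_main ?main) 0 [enc_dag ns] (enc_bool (T_sat T \<psi>)) (poly p (dag_size \<psi>))"
    if "d_DNNF \<psi>" "finite \<alpha>" "atoms \<psi> \<subseteq> \<alpha>" "T_reduced T \<alpha> \<psi>" "dag_listing \<psi> ns"
    for \<psi> :: "('t, 'b) atom form" and \<alpha> ns
  proof -
    define c where "c = check_bound (dag_size \<psi>) 0"
    have "c \<le> check_bound (dag_size \<psi>) (dag_size \<psi>)" unfolding c_def by (rule check_bound_mono) auto
    moreover have "computes (with_main ?main) 14 [PairD NilD NilD, enc_dag ns, NilD, enc_dag ns, NilD]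
        (enc_bool (T_sat T \<psi>)) c"
      using check_correct[OF that(1,5) consistent_Nil, of ?main] T_sat_iff[OF that(4,2,3)]
      by (simp add: c_def)
    ultimately show ?thesis
      unfolding p by (intro computes_main) (auto simp: wp_simps elim!: computesD)
  qed
  then show ?thesis using outputs_within_computes by blast
qed

lemma T_entails_program:
  "\<exists>prg p. \<forall>(\<psi> :: ('t, 'b) atom form) \<alpha> ns \<beta> ls.
     d_DNNF \<psi> \<and> finite \<alpha> \<and> atoms \<psi> \<subseteq> \<alpha> \<and> T_reduced T \<alpha> \<psi> \<and> dag_listing \<psi> ns \<and>
     clause_on \<alpha> \<beta> \<and> distinct ls \<and> \<beta> = Or (fset_of_list ls) \<longrightarrow>
     outputs_within prg [enc_dag ns, enc_literals ls] (enc_bool (T_entails T \<psi> \<beta>))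
       (poly p (dag_size \<psi> + dag_size \<beta>))"
proof -
  have "is_polynomial (\<lambda>n. check_bound n n + Suc n * (60 * Suc n + 60) + 60)"
    by (intro is_polynomial_intros is_polynomial_check_bound)
  then obtain p where p: "\<And>n. poly p n = check_bound n n + Suc n * (60 * Suc n + 60) + 60"
    unfolding is_polynomial_def by metis
  \<comment> \<open>No valuation falsifies a tautological clause, so it is an inadmissible context
    for the evaluation; such clauses are filtered out first and accepted.\<close>
  let ?main = "IfE (CallE 8 [Var 1, Var 1]) TrueE
    (NotE (CallE 14 [PairE NilE (Var 1), Var 0, NilE, Var 0, NilE]))"
  have "computes (with_main ?main) 0 [enc_dag ns, enc_literals ls]
      (enc_bool (T_entails T \<psi> (Or (fset_of_list ls))))
      (poly p (dag_size \<psi> + dag_size (Or (fset_of_list ls))))"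
    if "d_DNNF \<psi>" "finite \<alpha>" "atoms \<psi> \<subseteq> \<alpha>" "T_reduced T \<alpha> \<psi>" "dag_listing \<psi> ns"
      "clause_on \<alpha> (Or (fset_of_list ls))" "distinct ls"
    for \<psi> :: "('t, 'b) atom form" and \<alpha> ns ls
  proof -
    define N where "N = dag_size \<psi> + dag_size (Or (fset_of_list ls))"
    have lits: "\<forall>l \<in> set ls. is_literal l" and atoms: "\<And>l. l \<in> set ls \<Longrightarrow> atoms l \<subseteq> \<alpha>"
      using that(6) by (auto simp: clause_on_def fset_of_list.rep_eq)
    have len: "length ls \<le> N" using length_clause_le[OF that(7)] by (simp add: N_def)
    define b where "b \<longleftrightarrow> (\<exists>p a. literal p a \<in> set ls \<and> literal (\<not> p) a \<in> set ls)"
    define c where "c = check_bound (dag_size \<psi>) (length ls)"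
    define d where "d = Suc (length ls) * (60 * Suc (length ls) + 60)"
    have "c \<le> check_bound N N" unfolding c_def using len by (intro check_bound_mono) (auto simp: N_def)
    moreover have "d \<le> Suc N * (60 * Suc N + 60)"
      unfolding d_def using len by (intro mult_le_mono) auto
    ultimately have time: "c + d + 60 \<le> poly p N" unfolding p by linarith
    have taut: "computes (with_main ?main) 8 [enc_literals ls, enc_literals ls] (enc_bool b) d"
      unfolding b_def d_def by (rule taut_correct[OF lits lits])
    have ent: "T_entails T \<psi> (Or (fset_of_list ls)) \<longleftrightarrow> \<not> sat_avoiding ls \<psi>"
      by (rule T_entails_clause_iff[OF that(4,2,3) atoms])
    show ?thesis
    proof (cases b)
      case True
      then obtain q a where "literal q a \<in> set ls" "literal (\<not> q) a \<in> set ls"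
        unfolding b_def by blast
      then have "(\<exists>l \<in> set ls. sat v l)" for v by (cases "v a = q") (force intro: bexI)+
      then have "\<not> sat_avoiding ls \<psi>" unfolding sat_avoiding_def by blast
      with True taut time show ?thesis unfolding ent N_def[symmetric]
        by (intro computes_main) (auto simp: wp_simps enc_bool_eqs elim!: computesD)
    next
      case False
      then have "consistent ls" using lits unfolding b_def consistent_def by force
      note check_correct[OF that(1,5) this, of ?main, folded c_def]
      with False taut time show ?thesis unfolding ent N_def[symmetric]
        by (cases "sat_avoiding ls \<psi>"; intro computes_main)
          (auto simp: wp_simps enc_bool_eqs elim!: computesD)
    qed
  qed
  then show ?thesis using outputs_within_computes by blast
qed

text \<open>Counts have up to \<open>|\<alpha>| + 1\<close> bits and the list of atoms is input, so
  atoms of \<open>\<alpha>\<close> outside the formula enter the bound.\<close>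

lemma count_SMT_program:
  "\<exists>prg p. \<forall>(\<psi> :: ('t, 'b) atom form) \<alpha> ns as.
     d_DNNF \<psi> \<and> finite \<alpha> \<and> atoms \<psi> \<subseteq> \<alpha> \<and> T_reduced T \<alpha> \<psi> \<and> dag_listing \<psi> ns \<and>
     distinct as \<and> set as = \<alpha> \<longrightarrow>
     outputs_within prg [enc_dag ns, enc_atoms as] (enc_binary (count_SMT T \<alpha> \<psi>))
       (poly p (dag_size \<psi> + card (\<alpha> - atoms \<psi>)))"
proof -
  have "is_polynomial (\<lambda>n. eval_bound n (arith_bound n) + 30)"
    by (intro is_polynomial_intros is_polynomial_eval_bound is_polynomial_arith_bound)
  then obtain p where p: "\<And>n. poly p n = eval_bound n (arith_bound n) + 30"
    unfolding is_polynomial_def by metis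
  let ?main = "CallE 14 [PairE TrueE (Var 1), Var 0, NilE, Var 0, NilE]"
  have "computes (with_main ?main) 0 [enc_dag ns, enc_atoms as]
      (enc_binary (count_SMT T (set as) \<psi>)) (poly p (dag_size \<psi> + card (set as - atoms \<psi>)))"
    if "d_DNNF \<psi>" "atoms \<psi> \<subseteq> set as" "T_reduced T (set as) \<psi>" "dag_listing \<psi> ns" "distinct as"
    for \<psi> :: "('t, 'b) atom form" and ns as
  proof -
    define N where "N = dag_size \<psi> + card (set as - atoms \<psi>)"
    define c where "c = eval_bound (dag_size \<psi>) (arith_bound (length as))"
    have "length as \<le> N" unfolding N_def by (rule length_atoms_le[OF that(5,2)])
    then have "c \<le> eval_bound N (arith_bound N)"
      unfolding c_def by (intro eval_bound_mono arith_bound_mono) (simp_all add: N_def)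
    then have "c + 30 \<le> poly p N" by (simp add: p)
    moreover have "computes (with_main ?main) 14
        [PairD (PairD NilD NilD) (enc_atoms as), enc_dag ns, NilD, enc_dag ns, NilD]
        (enc_binary (count_SMT T (set as) \<psi>)) c"
      using count_correct[OF that(1,4,5,2), of ?main, folded c_def] card_H_assignments[OF that(3,2)]
      by (simp add: count_SMT_def enc_bool_eqs)
    ultimately show ?thesis
      unfolding N_def[symmetric] by (intro computes_main) (auto simp: wp_simps elim!: computesD)
  qed
  then show ?thesis using outputs_within_computes by blast
qed

lemma AllSMT_program:
  "\<exists>prg p. \<forall>(\<psi> :: ('t, 'b) atom form) \<alpha> ns as.
     d_DNNF \<psi> \<and> finite \<alpha> \<and> atoms \<psi> \<subseteq> \<alpha> \<and> T_reduced T \<alpha> \<psi> \<and> dag_listing \<psi> ns \<and>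
     distinct as \<and> set as = \<alpha> \<longrightarrow>
     (\<exists>out. presents_conjunctions out (AllSMT T \<alpha> \<psi>) \<and>
       outputs_within prg [enc_dag ns, enc_atoms as] out
         (poly p (dag_size \<psi> + card (AllSMT T \<alpha> \<psi>))))"
proof -
  \<comment> \<open>The cost of one call times the number of calls, with \<open>n\<close> bounding
    the number of outputs and, if there are any, the length of \<open>as\<close>.\<close>
  have "is_polynomial (\<lambda>n. (check_bound n n + 80) * (1 + 2 * n * n) + 30)"
    by (intro is_polynomial_intros is_polynomial_check_bound)
  then obtain p where p: "\<And>n. poly p n = (check_bound n n + 80) * (1 + 2 * n * n) + 30"
    unfolding is_polynomial_def by metis
  let ?main = "CallE 15 [Var 0, Var 1, NilE, NilE, NilE]"
  have "\<exists>out. presents_conjunctions out (AllSMT T (set as) \<psi>) \<and>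
      computes (with_main ?main) 0 [enc_dag ns, enc_atoms as] out
        (poly p (dag_size \<psi> + card (AllSMT T (set as) \<psi>)))"
    if "d_DNNF \<psi>" "atoms \<psi> \<subseteq> set as" "T_reduced T (set as) \<psi>" "dag_listing \<psi> ns" "distinct as"
    for \<psi> :: "('t, 'b) atom form" and ns as
  proof -
    define E where "E = enum \<psi> as []"
    define out :: "('t, 'b) atom data" where "out = enc_list (map (\<lambda>qs. enc_literals (lits qs)) E)"
    have all: "AllSMT T (set as) \<psi> = {cube as v |v. sat v \<psi>}"
      unfolding AllSMT_def by (rule H_assignments_T_reduced[OF that(3,2)])
    have pres: "presents_conjunctions out (AllSMT T (set as) \<psi>)"
      unfolding all out_def E_def by (rule presents_conjunctions_enum[OF that(5)])
    define N where "N = dag_size \<psi> + card (AllSMT T (set as) \<psi>)"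
    have len_E: "length E = card (AllSMT T (set as) \<psi>)"
      unfolding E_def all by (rule length_enum)
    \<comment> \<open>Once a model exists, there are at least as many outputs as atoms outside the
      formula.\<close>
    have len_as: "length as \<le> N" if "sat v \<psi>" for v
    proof -
      have "card (set as - atoms \<psi>) \<le> card (AllSMT T (set as) \<psi>)"
        unfolding AllSMT_def card_H_assignments[OF \<open>T_reduced T (set as) \<psi>\<close> \<open>atoms \<psi> \<subseteq> set as\<close>]
        using that \<open>atoms \<psi> \<subseteq> set as\<close> by (intro card_free_atoms_le_models) auto
      then show ?thesis
        using length_atoms_le[OF \<open>distinct as\<close> \<open>atoms \<psi> \<subseteq> set as\<close>] unfolding N_def by linarith
    qed
    define B where "B = check_bound N N + 80"
    have "computes (with_main ?main) 15
        [enc_dag ns, enc_atoms as, enc_literals (lits []), enc_literals (neg_lits []), enc_list []]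
        (enc_list (map (\<lambda>qs. enc_literals (lits qs)) (enum \<psi> as []) @ []))
        (B * (1 + 2 * length as * length (enum \<psi> as [])))"
    proof (rule enum_correct[OF that(1,4)])
      show "distinct (as @ map fst [])" using that(5) by simp
      fix k
      assume k: "k \<le> length ([] :: (('t, 'b) atom \<times> bool) list) +
        (if sat_avoiding (neg_lits []) \<psi> then length as else 0)"
      \<comment> \<open>Without models only the test with no assigned atoms takes place.\<close>
      have "k \<le> N"
      proof (cases "\<exists>v. sat v \<psi>")
        case True
        then show ?thesis using len_as k by (auto split: if_splits intro: order_trans)
      next
        case False
        then show ?thesis using k by (simp add: sat_avoiding_def)
      qed
      then show "check_bound (dag_size \<psi>) k + 80 \<le> B"
        unfolding B_def by (intro add_le_mono check_bound_mono) (simp_all add: N_def)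
    qed
    then have run: "computes (with_main ?main) 15 [enc_dag ns, enc_atoms as, NilD, NilD, NilD] out
        (B * (1 + 2 * length as * length E))"
      by (simp add: lits_def neg_lits_def out_def E_def)
    \<comment> \<open>Without outputs the product vanishes, even if \<open>as\<close> is longer than
      \<open>N\<close>.\<close>
    have "length as * length E \<le> N * N"
    proof (cases "E = []")
      case False
      then obtain v where "sat v \<psi>" unfolding E_def using set_enum[of \<psi> as "[]"] by fastforce
      then show ?thesis using len_as len_E unfolding N_def by (intro mult_le_mono) auto
    qed simp
    then have "B * (1 + 2 * length as * length E) \<le> B * (1 + 2 * N * N)"
      by (intro mult_le_mono2) (simp add: mult.assoc)
    then have "B * (1 + 2 * length as * length E) + 30 \<le> poly p N"
      unfolding p B_def[symmetric] by linarith
    with run have "computes (with_main ?main) 0 [enc_dag ns, enc_atoms as] out (poly p N)"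
      by (intro computes_main) (auto simp: wp_simps elim!: computesD)
    with pres show ?thesis unfolding N_def by blast
  qed
  then show ?thesis using outputs_within_computes by blast
qed

theorem theorem5p2:
  fixes T :: "('m, 't) smt_theory"
  shows
    "(\<exists>prg p. \<forall>(\<psi> :: ('t, 'b) atom form) \<alpha> ns.
        d_DNNF \<psi> \<and> finite \<alpha> \<and> atoms \<psi> \<subseteq> \<alpha> \<and> T_reduced T \<alpha> \<psi> \<and> dag_listing \<psi> ns \<longrightarrow>
        outputs_within prg [enc_dag ns] (enc_bool (T_sat T \<psi>)) (poly p (dag_size \<psi>)))
   \<and> (\<exists>prg p. \<forall>(\<psi> :: ('t, 'b) atom form) \<alpha> ns \<beta> ls.
        d_DNNF \<psi> \<and> finite \<alpha> \<and> atoms \<psi> \<subseteq> \<alpha> \<and> T_reduced T \<alpha> \<psi> \<and> dag_listing \<psi> ns \<and>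
        clause_on \<alpha> \<beta> \<and> distinct ls \<and> \<beta> = Or (fset_of_list ls) \<longrightarrow>
        outputs_within prg [enc_dag ns, enc_literals ls] (enc_bool (T_entails T \<psi> \<beta>))
          (poly p (dag_size \<psi> + dag_size \<beta>)))
   \<and> (\<exists>prg p. \<forall>(\<psi> :: ('t, 'b) atom form) \<alpha> ns as.
        d_DNNF \<psi> \<and> finite \<alpha> \<and> atoms \<psi> \<subseteq> \<alpha> \<and> T_reduced T \<alpha> \<psi> \<and> dag_listing \<psi> ns \<and>
        distinct as \<and> set as = \<alpha> \<longrightarrow>
        outputs_within prg [enc_dag ns, enc_atoms as] (enc_binary (count_SMT T \<alpha> \<psi>))
          (poly p (dag_size \<psi> + card (\<alpha> - atoms \<psi>))))
   \<and> (\<exists>prg p. \<forall>(\<psi> :: ('t, 'b) atom form) \<alpha> ns as.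
        d_DNNF \<psi> \<and> finite \<alpha> \<and> atoms \<psi> \<subseteq> \<alpha> \<and> T_reduced T \<alpha> \<psi> \<and> dag_listing \<psi> ns \<and>
        distinct as \<and> set as = \<alpha> \<longrightarrow>
        (\<exists>out. presents_conjunctions out (AllSMT T \<alpha> \<psi>) \<and>
          outputs_within prg [enc_dag ns, enc_atoms as] out
            (poly p (dag_size \<psi> + card (AllSMT T \<alpha> \<psi>)))))"
  by (intro conjI T_sat_program T_entails_program count_SMT_program AllSMT_program)

end
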